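(* If $j:V\to\overline V$ is the Boolean ultrapower by the ultrafilter $U$ on the complete Boolean algebra $\mathbb{B}$, then $\overline V=\{j(f)(b) : f:\mathbb{B}\to V,\ b\in j(\mathbb{B})\}$. More precisely, $\overline V=\{j(f)(b_A) : A\subseteq\mathbb{B}\text{ a maximal antichain},\ f:A\to V\}$, where $b_A$ is the unique member of $j(A)$ in the $\overline V$-generic filter $G$ on $j(\mathbb{B})$ arising from $[\dot G]_U$.
   Context: $\mathbb{B}$-names (elements of $V^{\mathbb{B}}$) are defined recursively: $\tau$ is a $\mathbb{B}$-name if $\tau$ is a set of pairs $\langle\sigma,b\rangle$ with $\sigma$ a $\mathbb{B}$-name and $b\in\mathbb{B}$. Boolean values: $[\![\tau\in\sigma]\!]=\bigvee_{\langle\eta,b\rangle\in\sigma}[\![\tau=\eta]\!]\wedge b$, $[\![\tau=\sigma]\!]=[\![\tau\subseteq\sigma]\!]\wedge[\![\sigma\subseteq\tau]\!]$, $[\![\tau\subseteq\sigma]\!]=\bigwedge_{\eta\in\mathrm{dom}(\tau)}(\neg[\![\eta\in\tau]\!]\vee[\![\eta\in\sigma]\!])$. For $x\in V$, $\check x=\{\langle\check y,1\rangle : y\in x\}$; $[\![\tau\in\check V]\!]=\bigvee_{x\in V}[\![\tau=\check x]\!]$; $\dot G=\{\langle\check b,b\rangle : b\in\mathbb{B}\}$. Let $\tau=_U\sigma$ iff $[\![\tau=\sigma]\!]\in U$, $\tau\in_U\sigma$ iff $[\![\tau\in\sigma]\!]\in U$; $[\tau]_U$ is the $=_U$-class of $\tau$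 (restricted to members of minimal rank). $V^{\mathbb{B}}/U=\{[\tau]_U : \tau\in V^{\mathbb{B}}\}$ under $\in_U$; the Boolean ultrapower is $\check V_U=\{[\tau]_U : [\![\tau\in\check V]\!]\in U\}$ under $\in_U$, with elementary embedding $j_U(x)=[\check x]_U$. In the claim $j:V\to\overline V$ is $j_U:V\to\check V_U$ (up to isomorphism; $\overline V$ need not be well-founded). The structure $V^{\mathbb{B}}/U$ is a forcing extension of $\check V_U$: it satisfies that $G=[\dot G]_U$ is a $\check V_U$-generic ultrafilter on $j_U(\mathbb{B})$. Expressions such as $j(f)(b)$ are evaluated in the model $\overline V$: $j(f)$ is a function in the sense of $\overline V$, and $b$ ranges over $\overline V$-elements of its domain. All functions $f$ and antichains $A$ are in $V$. *)

theory Defs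
  imports "HOL-Algebra.Complete_Lattice" "HOL-Library.Multiset"
begin

section \<open>The universe of sets\<close>

text \<open>
  A type of this class plays the role of \<open>V\<close>.  Proper classes are predicates (or HOL sets) over
  the type, so the axioms quantifying over classes are stated in second-order form.
  The axiom of choice is not listed: it follows from \<open>replacement\<close> applied to a choice function
  of the logic.
\<close>

class zfc_universe =
  fixes vmem :: "'a \<Rightarrow> 'a \<Rightarrow> bool"  (infix \<open>\<in>\<^sub>V\<close> 50)
  assumes extensionality: "(\<And>z. z \<in>\<^sub>V x \<longleftrightarrow> z \<in>\<^sub>V y) \<Longrightarrow> x = y"
    and foundation: "wf {(x, y). x \<in>\<^sub>V y}"
    and pairing: "\<exists>p. \<forall>z. z \<in>\<^sub>V p \<longleftrightarrow> z = x \<or> z = y"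
    and union: "\<exists>u. \<forall>z. z \<in>\<^sub>V u \<longleftrightarrow> (\<exists>y. y \<in>\<^sub>V x \<and> z \<in>\<^sub>V y)"
    and powerset: "\<exists>p. \<forall>z. z \<in>\<^sub>V p \<longleftrightarrow> (\<forall>w. w \<in>\<^sub>V z \<longrightarrow> w \<in>\<^sub>V x)"
    and infinity: "\<exists>i. (\<exists>e. e \<in>\<^sub>V i \<and> (\<forall>z. \<not> z \<in>\<^sub>V e)) \<and>
        (\<forall>x. x \<in>\<^sub>V i \<longrightarrow> (\<exists>s. s \<in>\<^sub>V i \<and> (\<forall>z. z \<in>\<^sub>V s \<longleftrightarrow> z \<in>\<^sub>V x \<or> z = x)))"
    and separation: "\<exists>y. \<forall>z. z \<in>\<^sub>V y \<longleftrightarrow> z \<in>\<^sub>V x \<and> P z"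
    and replacement: "\<exists>y. \<forall>z. z \<in>\<^sub>V y \<longleftrightarrow> (\<exists>u. u \<in>\<^sub>V x \<and> z = F u)"

definition elts :: "'v::zfc_universe \<Rightarrow> 'v set" where
  "elts x = {y. y \<in>\<^sub>V x}"

text \<open>The element of \<open>V\<close> with a given extension (meaningful only if the class is a set of \<open>V\<close>).\<close>

definition vset :: "'v::zfc_universe set \<Rightarrow> 'v" where
  "vset X = (THE x. elts x = X)"

definition opair :: "'v::zfc_universe \<Rightarrow> 'v \<Rightarrow> 'v" where
  "opair a b = vset {vset {a, a}, vset {a, b}}"

lemma elts_vset: "\<exists>x. elts x = X \<Longrightarrow> elts (vset X) = X"
proof -
  assume "\<exists>x. elts x = X"
  then obtain x where x: "elts x = X" ..
  have "(THE x. elts x = X) = x"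
    by (rule the_equality) (use x in \<open>auto simp: elts_def intro: extensionality\<close>)
  with x show ?thesis
    by (simp add: vset_def)
qed

lemma elts_vset_pair: "elts (vset {a, b}) = {a, b}"
  by (rule elts_vset) (use pairing[of a b] in \<open>auto simp: elts_def\<close>)

lemma wf_vmem_trancl: "wf ({(x, y). x \<in>\<^sub>V y}\<^sup>+)"
  by (intro wf_trancl foundation)

lemma opair_fst_below:
  assumes "opair a b \<in>\<^sub>V x"
  shows "(a, x) \<in> {(x, y). x \<in>\<^sub>V y}\<^sup>+"
proof -
  have "a \<in>\<^sub>V vset {a, a}" "vset {a, a} \<in>\<^sub>V opair a b"
    using elts_vset_pair[of a a] elts_vset_pair[of "vset {a, a}" "vset {a, b}"]
    by (auto simp: elts_def opair_def)
  with assms have "(a, vset {a, a}) \<in> {(x, y). x \<in>\<^sub>V y}"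
    "(vset {a, a}, opair a b) \<in> {(x, y). x \<in>\<^sub>V y}" "(opair a b, x) \<in> {(x, y). x \<in>\<^sub>V y}"
    by simp_all
  then show ?thesis
    by (rule trancl_into_trancl[OF trancl_into_trancl[OF r_into_trancl]])
qed

function vrank :: "'v::zfc_universe \<Rightarrow> 'v" where
  "vrank x = vset (\<Union>y\<in>elts x. insert (vrank y) (elts (vrank y)))"
  by auto
termination
  by (relation "{(x, y). x \<in>\<^sub>V y}") (auto simp: foundation elts_def)

section \<open>Complete Boolean algebras and ultrafilters\<close>

definition complete_boolean_lattice :: "'v gorder \<Rightarrow> bool" where
  "complete_boolean_lattice \<BB> \<longleftrightarrow> complete_lattice \<BB> \<and>
     (\<forall>a\<in>carrier \<BB>. \<forall>b\<in>carrier \<BB>. \<forall>c\<in>carrier \<BB>.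
        a \<sqinter>\<^bsub>\<BB>\<^esub> (b \<squnion>\<^bsub>\<BB>\<^esub> c) = (a \<sqinter>\<^bsub>\<BB>\<^esub> b) \<squnion>\<^bsub>\<BB>\<^esub> (a \<sqinter>\<^bsub>\<BB>\<^esub> c)) \<and>
     (\<forall>a\<in>carrier \<BB>. \<exists>c\<in>carrier \<BB>. a \<sqinter>\<^bsub>\<BB>\<^esub> c = \<bottom>\<^bsub>\<BB>\<^esub> \<and> a \<squnion>\<^bsub>\<BB>\<^esub> c = \<top>\<^bsub>\<BB>\<^esub>)"

definition bcompl :: "'v gorder \<Rightarrow> 'v \<Rightarrow> 'v" where
  "bcompl \<BB> a = (THE c. c \<in> carrier \<BB> \<and> a \<sqinter>\<^bsub>\<BB>\<^esub> c = \<bottom>\<^bsub>\<BB>\<^esub> \<and> a \<squnion>\<^bsub>\<BB>\<^esub> c = \<top>\<^bsub>\<BB>\<^esub>)"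

definition ultrafilter_on :: "'v gorder \<Rightarrow> 'v set \<Rightarrow> bool" where
  "ultrafilter_on \<BB> U \<longleftrightarrow> U \<subseteq> carrier \<BB> \<and> \<top>\<^bsub>\<BB>\<^esub> \<in> U \<and> \<bottom>\<^bsub>\<BB>\<^esub> \<notin> U \<and>
     (\<forall>a\<in>U. \<forall>b\<in>carrier \<BB>. a \<sqsubseteq>\<^bsub>\<BB>\<^esub> b \<longrightarrow> b \<in> U) \<and>
     (\<forall>a\<in>U. \<forall>b\<in>U. a \<sqinter>\<^bsub>\<BB>\<^esub> b \<in> U) \<and>
     (\<forall>a\<in>carrier \<BB>. a \<in> U \<or> bcompl \<BB> a \<in> U)"

text \<open>Antichains consist of nonzero elements.\<close>

definition antichain :: "'v gorder \<Rightarrow> 'v set \<Rightarrow> bool" where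
  "antichain \<BB> A \<longleftrightarrow> A \<subseteq> carrier \<BB> - {\<bottom>\<^bsub>\<BB>\<^esub>} \<and>
     (\<forall>a\<in>A. \<forall>b\<in>A. a \<noteq> b \<longrightarrow> a \<sqinter>\<^bsub>\<BB>\<^esub> b = \<bottom>\<^bsub>\<BB>\<^esub>)"

definition maximal_antichain :: "'v gorder \<Rightarrow> 'v set \<Rightarrow> bool" where
  "maximal_antichain \<BB> A \<longleftrightarrow> antichain \<BB> A \<and> (\<forall>A'. antichain \<BB> A' \<and> A \<subseteq> A' \<longrightarrow> A' = A)"

section \<open>Names and Boolean values\<close>

inductive bname :: "'v::zfc_universe gorder \<Rightarrow> 'v \<Rightarrow> bool" for \<BB> where
  "(\<forall>p. p \<in>\<^sub>V \<tau> \<longrightarrow> (\<exists>\<sigma> b. p = opair \<sigma> b \<and> bname \<BB> \<sigma> \<and> b \<in> carrier \<BB>)) \<Longrightarrow> bname \<BB> \<tau>"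

lemma bv_weight_eq:
  assumes "(\<eta>, \<sigma>) \<in> r"
  shows "({#\<tau>, \<tau>, \<eta>, \<eta>#}, {#\<tau>, \<tau>, \<sigma>#}) \<in> mult r"
proof -
  have "({#\<tau>, \<tau>#} + {#\<eta>, \<eta>#}, {#\<tau>, \<tau>#} + {#\<sigma>#}) \<in> mult r"
    by (rule one_step_implies_mult) (use assms in auto)
  moreover have "{#\<tau>, \<tau>#} + {#\<eta>, \<eta>#} = {#\<tau>, \<tau>, \<eta>, \<eta>#}" "{#\<tau>, \<tau>#} + {#\<sigma>#} = {#\<tau>, \<tau>, \<sigma>#}"
    by simp_all
  ultimately show ?thesis by (simp only:)
qed

lemma bv_weight_mem:
  assumes "(\<eta>, \<tau>) \<in> r"
  shows "({#\<eta>, \<eta>, \<tau>#}, {#\<tau>, \<tau>, \<sigma>, \<sigma>#}) \<in> mult r"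
    and "({#\<eta>, \<eta>, \<sigma>#}, {#\<tau>, \<tau>, \<sigma>, \<sigma>#}) \<in> mult r"
proof -
  have "({#\<tau>#} + {#\<eta>, \<eta>#}, {#\<tau>#} + {#\<tau>, \<sigma>, \<sigma>#}) \<in> mult r"
    by (rule one_step_implies_mult) (use assms in auto)
  moreover have "{#\<tau>#} + {#\<eta>, \<eta>#} = {#\<eta>, \<eta>, \<tau>#}" "{#\<tau>#} + {#\<tau>, \<sigma>, \<sigma>#} = {#\<tau>, \<tau>, \<sigma>, \<sigma>#}"
    by simp_all
  ultimately show "({#\<eta>, \<eta>, \<tau>#}, {#\<tau>, \<tau>, \<sigma>, \<sigma>#}) \<in> mult r" by (simp only:)
  have "({#\<sigma>#} + {#\<eta>, \<eta>#}, {#\<sigma>#} + {#\<tau>, \<tau>, \<sigma>#}) \<in> mult r"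
    by (rule one_step_implies_mult) (use assms in auto)
  moreover have "{#\<sigma>#} + {#\<eta>, \<eta>#} = {#\<eta>, \<eta>, \<sigma>#}" "{#\<sigma>#} + {#\<tau>, \<tau>, \<sigma>#} = {#\<tau>, \<tau>, \<sigma>, \<sigma>#}"
    by simp_all
  ultimately show "({#\<eta>, \<eta>, \<sigma>#}, {#\<tau>, \<tau>, \<sigma>, \<sigma>#}) \<in> mult r" by (simp only:)
qed

text \<open>
  The Boolean values of \<open>\<tau> \<in> \<sigma>\<close>, \<open>\<tau> = \<sigma>\<close> and \<open>\<tau> \<subseteq> \<sigma>\<close>.  The recursion terminates along the
  multiset order on the weights \<open>{\<tau>, \<tau>, \<sigma>}\<close>, \<open>{\<tau>, \<tau>, \<sigma>, \<sigma>}\<close> and \<open>{\<tau>, \<tau>, \<sigma>, \<sigma>}\<close>, respectively.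
\<close>

function (sequential)
      bv_mem :: "'v::zfc_universe gorder \<Rightarrow> 'v \<Rightarrow> 'v \<Rightarrow> 'v"
  and bv_eq :: "'v gorder \<Rightarrow> 'v \<Rightarrow> 'v \<Rightarrow> 'v"
  and bv_sub :: "'v gorder \<Rightarrow> 'v \<Rightarrow> 'v \<Rightarrow> 'v" where
  "bv_mem \<BB> \<tau> \<sigma> =
     \<Squnion>\<^bsub>\<BB>\<^esub> ((\<lambda>(\<eta>, b). bv_eq \<BB> \<tau> \<eta> \<sqinter>\<^bsub>\<BB>\<^esub> b) ` {(\<eta>, b). opair \<eta> b \<in>\<^sub>V \<sigma>})"
| "bv_eq \<BB> \<tau> \<sigma> = bv_sub \<BB> \<tau> \<sigma> \<sqinter>\<^bsub>\<BB>\<^esub> bv_sub \<BB> \<sigma> \<tau>"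
| "bv_sub \<BB> \<tau> \<sigma> =
     \<Sqinter>\<^bsub>\<BB>\<^esub> ((\<lambda>\<eta>. bcompl \<BB> (bv_mem \<BB> \<eta> \<tau>) \<squnion>\<^bsub>\<BB>\<^esub> bv_mem \<BB> \<eta> \<sigma>) ` {\<eta>. \<exists>b. opair \<eta> b \<in>\<^sub>V \<tau>})"
  by pat_completeness auto
termination
proof (relation "inv_image (mult ({(x, y). x \<in>\<^sub>V y}\<^sup>+) <*lex*> less_than)
    (\<lambda>z. case z of Inl (\<BB>, \<tau>, \<sigma>) \<Rightarrow> ({#\<tau>, \<tau>, \<sigma>#}, 0)
       | Inr (Inl (\<BB>, \<tau>, \<sigma>)) \<Rightarrow> ({#\<tau>, \<tau>, \<sigma>, \<sigma>#}, Suc 0)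
       | Inr (Inr (\<BB>, \<tau>, \<sigma>)) \<Rightarrow> ({#\<tau>, \<tau>, \<sigma>, \<sigma>#}, 0))", goal_cases)
  case 1
  show ?case by (intro wf_inv_image wf_lex_prod wf_mult wf_vmem_trancl wf_less_than)
next
  case (2 \<BB> \<tau> \<sigma> x \<eta> b)
  then have "(\<eta>, \<sigma>) \<in> {(x, y). x \<in>\<^sub>V y}\<^sup>+" by (auto intro: opair_fst_below)
  from bv_weight_eq[OF this] show ?case by simp
next
  case (3 \<BB> \<tau> \<sigma>)
  show ?case by simp
next
  case (4 \<BB> \<tau> \<sigma>)
  have "{#\<sigma>, \<sigma>, \<tau>, \<tau>#} = {#\<tau>, \<tau>, \<sigma>, \<sigma>#}" by (simp only: add_mset_commute)
  then show ?case by simp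
next
  case (5 \<BB> \<tau> \<sigma> \<eta>)
  then have "(\<eta>, \<tau>) \<in> {(x, y). x \<in>\<^sub>V y}\<^sup>+" by (auto intro: opair_fst_below)
  from bv_weight_mem(1)[OF this] show ?case by simp
next
  case (6 \<BB> \<tau> \<sigma> \<eta>)
  then have "(\<eta>, \<tau>) \<in> {(x, y). x \<in>\<^sub>V y}\<^sup>+" by (auto intro: opair_fst_below)
  from bv_weight_mem(2)[OF this] show ?case by simp
qed

declare vrank.simps [simp del] bv_mem.simps [simp del] bv_eq.simps [simp del] bv_sub.simps [simp del]

function check_name :: "'v::zfc_universe gorder \<Rightarrow> 'v \<Rightarrow> 'v" where
  "check_name \<BB> x = vset ((\<lambda>y. opair (check_name \<BB> y) \<top>\<^bsub>\<BB>\<^esub>) ` elts x)"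
  by auto
termination
  by (relation "inv_image {(x, y). x \<in>\<^sub>V y} snd") (auto simp: foundation elts_def)

declare check_name.simps [simp del]

definition bv_ground :: "'v::zfc_universe gorder \<Rightarrow> 'v \<Rightarrow> 'v" where
  "bv_ground \<BB> \<tau> = \<Squnion>\<^bsub>\<BB>\<^esub> (range (\<lambda>x. bv_eq \<BB> \<tau> (check_name \<BB> x)))"

definition generic_name :: "'v::zfc_universe gorder \<Rightarrow> 'v" where
  "generic_name \<BB> = vset ((\<lambda>b. opair (check_name \<BB> b) b) ` carrier \<BB>)"

section \<open>The Boolean ultrapower\<close>

text \<open>The \<open>=\<^sub>U\<close>-class of \<open>\<tau>\<close>, restricted to its members of minimal rank.\<close>

definition ucls :: "'v::zfc_universe gorder \<Rightarrow> 'v set \<Rightarrow> 'v \<Rightarrow> 'v set" where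
  "ucls \<BB> U \<tau> = {\<sigma>. bname \<BB> \<sigma> \<and> bv_eq \<BB> \<sigma> \<tau> \<in> U \<and>
     (\<forall>\<rho>. bname \<BB> \<rho> \<and> bv_eq \<BB> \<rho> \<tau> \<in> U \<longrightarrow> \<not> vrank \<rho> \<in>\<^sub>V vrank \<sigma>)}"

definition umem :: "'v::zfc_universe gorder \<Rightarrow> 'v set \<Rightarrow> 'v set \<Rightarrow> 'v set \<Rightarrow> bool" where
  "umem \<BB> U X Y \<longleftrightarrow> (\<exists>\<tau>\<in>X. \<exists>\<sigma>\<in>Y. bv_mem \<BB> \<tau> \<sigma> \<in> U)"

definition boolean_ultrapower :: "'v::zfc_universe gorder \<Rightarrow> 'v set \<Rightarrow> 'v set set" where
  "boolean_ultrapower \<BB> U = {ucls \<BB> U \<tau> | \<tau>. bname \<BB> \<tau> \<and> bv_ground \<BB> \<tau> \<in> U}"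

definition uemb :: "'v::zfc_universe gorder \<Rightarrow> 'v set \<Rightarrow> 'v \<Rightarrow> 'v set" where
  "uemb \<BB> U x = ucls \<BB> U (check_name \<BB> x)"

text \<open>
  The generic filter, as the set of those elements of the Boolean ultrapower that
  \<open>V\<^sup>\<BB>/U\<close> believes to belong to the class of the canonical name.
\<close>

definition generic_filter :: "'v::zfc_universe gorder \<Rightarrow> 'v set \<Rightarrow> 'v set set" where
  "generic_filter \<BB> U = {b \<in> boolean_ultrapower \<BB> U. umem \<BB> U b (ucls \<BB> U (generic_name \<BB>))}"

definition generic_elt :: "'v::zfc_universe gorder \<Rightarrow> 'v set \<Rightarrow> 'v \<Rightarrow> 'v set" where
  "generic_elt \<BB> U A = (THE b. b \<in> generic_filter \<BB> U \<and> umem \<BB> U b (uemb \<BB> U A))"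

section \<open>Functions in the sense of a structure\<close>

text \<open>
  Satisfaction, in a structure \<open>(M, E)\<close> for the language of set theory, of the usual formulas
  saying that \<open>p\<close> is the unordered pair or the (Kuratowski) ordered pair of \<open>a\<close> and \<open>b\<close>, and
  that \<open>f\<close> is a function with domain \<open>D\<close>; and the value that \<open>f\<close> takes at \<open>a\<close> according to
  the structure.
\<close>

definition sat_upair :: "'m set \<Rightarrow> ('m \<Rightarrow> 'm \<Rightarrow> bool) \<Rightarrow> 'm \<Rightarrow> 'm \<Rightarrow> 'm \<Rightarrow> bool" where
  "sat_upair M E a b p \<longleftrightarrow> (\<forall>z\<in>M. E z p \<longleftrightarrow> z = a \<or> z = b)"

definition sat_opair :: "'m set \<Rightarrow> ('m \<Rightarrow> 'm \<Rightarrow> bool) \<Rightarrow> 'm \<Rightarrow> 'm \<Rightarrow> 'm \<Rightarrow> bool" where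
  "sat_opair M E a b p \<longleftrightarrow>
     (\<exists>u\<in>M. \<exists>v\<in>M. sat_upair M E a a u \<and> sat_upair M E a b v \<and> sat_upair M E u v p)"

definition sat_maps :: "'m set \<Rightarrow> ('m \<Rightarrow> 'm \<Rightarrow> bool) \<Rightarrow> 'm \<Rightarrow> 'm \<Rightarrow> 'm \<Rightarrow> bool" where
  "sat_maps M E f a y \<longleftrightarrow> (\<exists>p\<in>M. sat_opair M E a y p \<and> E p f)"

definition sat_function :: "'m set \<Rightarrow> ('m \<Rightarrow> 'm \<Rightarrow> bool) \<Rightarrow> 'm \<Rightarrow> 'm \<Rightarrow> bool" where
  "sat_function M E f D \<longleftrightarrow>
     (\<forall>p\<in>M. E p f \<longrightarrow> (\<exists>a\<in>M. \<exists>y\<in>M. E a D \<and> sat_opair M E a y p)) \<and>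
     (\<forall>a\<in>M. E a D \<longrightarrow> (\<exists>!y. y \<in> M \<and> sat_maps M E f a y))"

definition sat_apply :: "'m set \<Rightarrow> ('m \<Rightarrow> 'm \<Rightarrow> bool) \<Rightarrow> 'm \<Rightarrow> 'm \<Rightarrow> 'm" where
  "sat_apply M E f a = (THE y. y \<in> M \<and> sat_maps M E f a y)"

abbreviation vfunction :: "'v::zfc_universe \<Rightarrow> 'v \<Rightarrow> bool" where
  "vfunction f D \<equiv> sat_function UNIV (\<in>\<^sub>V) f D"

abbreviation ufunction ::
    "'v::zfc_universe gorder \<Rightarrow> 'v set \<Rightarrow> 'v set \<Rightarrow> 'v set \<Rightarrow> bool" where
  "ufunction \<BB> U F D \<equiv> sat_function (boolean_ultrapower \<BB> U) (umem \<BB> U) F D"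

abbreviation uapply ::
    "'v::zfc_universe gorder \<Rightarrow> 'v set \<Rightarrow> 'v set \<Rightarrow> 'v set \<Rightarrow> 'v set" where
  "uapply \<BB> U F b \<equiv> sat_apply (boolean_ultrapower \<BB> U) (umem \<BB> U) F b"

end

theory Submission
  imports Defs
begin

text \<open>
  Write \<open>x\<^sup>\<or>\<close> for the check name of \<open>x\<close>, and call a name \<open>\<tau>\<close> with \<open>\<lbrakk>\<tau> \<in> V\<^sup>\<or>\<rbrakk> \<in> U\<close> a
  ground name.  It behaves like a random variable with values in \<open>V\<close>: the Boolean values \<open>\<lbrakk>\<tau> = x\<^sup>\<or>\<rbrakk>\<close> are pairwise incompatible, since distinct \<open>x\<close> have
  check names that are unequal with value \<open>\<top>\<close>, and their supremum lies in \<open>U\<close>.  Hence the classes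
  \<open>P\<close> with \<open>\<Squnion>{\<lbrakk>\<tau> = x\<^sup>\<or>\<rbrakk> | P x} \<in> U\<close> form an ultrafilter of classes of \<open>V\<close>, the law of \<open>\<tau>\<close>.  By the
  mixing lemma (\<open>mixing\<close>), every class function \<open>g\<close> yields a name for \<open>g(\<tau>)\<close>; the classes of these
  names form a copy of the ordinary ultrapower of \<open>V\<close> by the law of \<open>\<tau>\<close> (\<open>val_eq_iff\<close>,
  \<open>umem_val_iff\<close>).  Two ground names are functions of a third one, which codes the pair of them
  (\<open>common_refinement\<close>).  So the Boolean ultrapower is a directed limit of ordinary ultrapowers,
  and the theorem of Los holds formula by formula: an existential quantifier over the limit is
  handled by passing to a common refinement in one direction and by choosing witnesses pointwise
  in the other (\<open>Los_ex\<close>).  Applied to the formulas for ordered pairs and functions this gives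
  \<open>Los_maps\<close> and \<open>Los_function\<close>, so \<open>j(f)\<close> is a function in the ultrapower and is evaluated
  pointwise.

  To write a given element \<open>[\<tau>]\<close> as \<open>j(f)(b\<^sub>A)\<close>, take \<open>A\<close> to consist of the nonzero values
  \<open>\<lbrakk>\<tau> = x\<^sup>\<or>\<rbrakk>\<close> together with the complement of their supremum, and let \<open>f\<close> send \<open>\<lbrakk>\<tau> = x\<^sup>\<or>\<rbrakk>\<close> back to
  \<open>x\<close>.  The image of \<open>\<tau>\<close> under \<open>x \<mapsto> \<lbrakk>\<tau> = x\<^sup>\<or>\<rbrakk>\<close> lies in \<open>j(A)\<close> and in the generic filter, so it is
  \<open>b\<^sub>A\<close>, and \<open>f\<close> maps it to \<open>\<tau>\<close> (\<open>ultrapower_element_representation\<close>).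

  In general \<open>b\<^sub>A\<close> exists because the elements of \<open>A\<close>, being incompatible with supremum \<open>\<top>\<close>, can be
  mixed into one name that each \<open>a \<in> A\<close> forces to be \<open>a\<^sup>\<or>\<close>.  It is unique because a name that is
  forced into both \<open>A\<^sup>\<or>\<close> and the generic filter is \<open>a\<^sup>\<or>\<close> only below \<open>a\<close>, where it agrees with the
  mixed name (\<open>generic_elt_unique\<close>).
\<close>

section \<open>Sets of the universe\<close>

definition small :: "'v::zfc_universe set \<Rightarrow> bool" where
  "small X \<longleftrightarrow> (\<exists>x. elts x = X)"

lemma small_elts [simp]: "small (elts x)"
  by (auto simp: small_def)

lemma elts_vset_small: "small X \<Longrightarrow> elts (vset X) = X"
  by (simp add: small_def elts_vset)

lemma vmem_iff_elts: "x \<in>\<^sub>V y \<longleftrightarrow> x \<in> elts y"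
  by (simp add: elts_def)

lemma elts_inject: "elts x = elts y \<Longrightarrow> x = y"
  by (rule extensionality) (auto simp: elts_def)

lemma small_subset:
  assumes "small X" "Y \<subseteq> X"
  shows "small Y"
proof -
  obtain x where x: "elts x = X" using assms by (auto simp: small_def)
  obtain y where "\<forall>z. z \<in>\<^sub>V y \<longleftrightarrow> z \<in>\<^sub>V x \<and> z \<in> Y"
    using separation[of x "\<lambda>z. z \<in> Y"] by blast
  then have "elts y = Y" using x assms(2) by (auto simp: elts_def)
  then show ?thesis by (auto simp: small_def)
qed

lemma small_image:
  fixes F :: "'v::zfc_universe \<Rightarrow> 'v"
  assumes "small X"
  shows "small (F ` X)"
proof -
  obtain x where x: "elts x = X" using assms by (auto simp: small_def)
  obtain y where "\<forall>z. z \<in>\<^sub>V y \<longleftrightarrow> (\<exists>u. u \<in>\<^sub>V x \<and> z = F u)"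
    using replacement[of x F] by blast
  then have "elts y = F ` X" using x by (auto simp: elts_def)
  then show ?thesis by (auto simp: small_def)
qed

lemma small_UN:
  fixes F :: "'v::zfc_universe \<Rightarrow> 'v set"
  assumes "small X" "\<And>x. x \<in> X \<Longrightarrow> small (F x)"
  shows "small (\<Union>x\<in>X. F x)"
proof -
  obtain y where y: "elts y = (\<lambda>x. vset (F x)) ` X"
    using small_image[OF assms(1)] unfolding small_def by blast
  obtain u where u: "\<forall>z. z \<in>\<^sub>V u \<longleftrightarrow> (\<exists>w. w \<in>\<^sub>V y \<and> z \<in>\<^sub>V w)"
    using union[of y] by blast
  have "elts u = (\<Union>w\<in>elts y. elts w)"
    using u by (auto simp: elts_def)
  also have "\<dots> = (\<Union>x\<in>X. F x)"
    using assms(2) by (auto simp: y elts_vset_small)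
  finally show ?thesis by (auto simp: small_def)
qed

lemma vset_pair_eq_iff: "vset {a, b} = vset {c, d} \<longleftrightarrow> {a, b} = {c, d}"
  by (metis elts_vset_pair)

lemma opair_eq_iff [simp]: "opair a b = opair c d \<longleftrightarrow> a = c \<and> b = d"
proof -
  have "vset {a, a} = vset {c, d} \<longleftrightarrow> {a, a} = {c, d}" for a c d :: 'a
    by (rule vset_pair_eq_iff)
  moreover have "vset {c, d} = vset {a, a} \<longleftrightarrow> {c, d} = {a, a}" for a c d :: 'a
    by (rule vset_pair_eq_iff)
  ultimately show ?thesis
    unfolding opair_def vset_pair_eq_iff doubleton_eq_iff by (auto simp: doubleton_eq_iff)
qed

lemma sat_upair_universe:
  "sat_upair UNIV (\<in>\<^sub>V) a b p \<longleftrightarrow> p = vset {a, b}"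
proof -
  have "sat_upair UNIV (\<in>\<^sub>V) a b p \<longleftrightarrow> elts p = {a, b}"
    by (auto simp: sat_upair_def elts_def)
  also have "\<dots> \<longleftrightarrow> p = vset {a, b}"
    by (metis elts_vset_pair elts_inject)
  finally show ?thesis .
qed

lemma sat_opair_universe:
  "sat_opair UNIV (\<in>\<^sub>V) a b p \<longleftrightarrow> p = opair a b"
  by (simp add: sat_opair_def sat_upair_universe opair_def)

lemma sat_maps_universe:
  "sat_maps UNIV (\<in>\<^sub>V) f a y \<longleftrightarrow> opair a y \<in>\<^sub>V f"
  by (simp add: sat_maps_def sat_opair_universe)

definition graph :: "('v::zfc_universe \<Rightarrow> 'v) \<Rightarrow> 'v \<Rightarrow> 'v" where
  "graph g D = vset ((\<lambda>x. opair x (g x)) ` elts D)"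

lemma opair_in_graph_iff: "opair x y \<in>\<^sub>V graph g D \<longleftrightarrow> x \<in>\<^sub>V D \<and> y = g x"
  by (auto simp: graph_def vmem_iff_elts elts_vset_small small_image)

lemma vfunction_graph: "vfunction (graph g D) D"
  unfolding sat_function_def sat_maps_universe sat_opair_universe opair_in_graph_iff
  by (auto simp: graph_def vmem_iff_elts elts_vset_small small_image)

section \<open>Complete Boolean algebras\<close>

locale complete_boolean_algebra = complete_lattice L for L :: "'v gorder" (structure) +
  assumes boolean: "complete_boolean_lattice L"
begin

lemma meet_join_distrib:
  "\<lbrakk>a \<in> carrier L; b \<in> carrier L; c \<in> carrier L\<rbrakk> \<Longrightarrow> a \<sqinter> (b \<squnion> c) = (a \<sqinter> b) \<squnion> (a \<sqinter> c)"
  using boolean by (simp add: complete_boolean_lattice_def)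

lemma le_meet_iff:
  "\<lbrakk>p \<in> carrier L; a \<in> carrier L; b \<in> carrier L\<rbrakk> \<Longrightarrow> p \<sqsubseteq> a \<sqinter> b \<longleftrightarrow> p \<sqsubseteq> a \<and> p \<sqsubseteq> b"
  by (meson le_trans meet_closed meet_le meet_left meet_right)

lemma le_bot_iff: "a \<in> carrier L \<Longrightarrow> a \<sqsubseteq> \<bottom> \<longleftrightarrow> a = \<bottom>"
  by (metis bottom_closed bottom_lower le_antisym)

lemma top_le_iff: "a \<in> carrier L \<Longrightarrow> \<top> \<sqsubseteq> a \<longleftrightarrow> a = \<top>"
  by (metis top_closed top_higher le_antisym)

lemma complement_unique:
  assumes "a \<in> carrier L" "c \<in> carrier L" "d \<in> carrier L"
    and "a \<sqinter> c = \<bottom>" "a \<squnion> c = \<top>" "a \<sqinter> d = \<bottom>" "a \<squnion> d = \<top>"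
  shows "c = d"
proof -
  have "x \<sqsubseteq> y" if [simp]: "x \<in> carrier L" "y \<in> carrier L" and "a \<sqinter> x = \<bottom>" "a \<squnion> y = \<top>" for x y
  proof -
    note [simp] = assms(1)
    have "x \<sqsubseteq> a \<squnion> y" using that by simp
    then have "x = x \<sqinter> (a \<squnion> y)" by (subst (asm) le_iff_join) auto
    also have "\<dots> = (x \<sqinter> a) \<squnion> (x \<sqinter> y)" by (simp add: meet_join_distrib)
    also have "\<dots> = \<bottom> \<squnion> (x \<sqinter> y)"
      using that(3) by (simp only: meet_comm)
    also have "\<dots> \<sqsubseteq> y" by (intro join_le) (auto simp: meet_right)
    finally show ?thesis .
  qed
  then show ?thesis using assms by (intro le_antisym) auto
qed

lemma bcompl:
  assumes "a \<in> carrier L"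
  shows "bcompl L a \<in> carrier L" "a \<sqinter> bcompl L a = \<bottom>" "a \<squnion> bcompl L a = \<top>"
proof -
  obtain c where c: "c \<in> carrier L \<and> a \<sqinter> c = \<bottom> \<and> a \<squnion> c = \<top>"
    using boolean assms by (auto simp: complete_boolean_lattice_def)
  have "bcompl L a \<in> carrier L \<and> a \<sqinter> bcompl L a = \<bottom> \<and> a \<squnion> bcompl L a = \<top>"
    unfolding bcompl_def by (rule theI[of _ c]) (use c complement_unique assms in blast)+
  then show "bcompl L a \<in> carrier L" "a \<sqinter> bcompl L a = \<bottom>" "a \<squnion> bcompl L a = \<top>"
    by auto
qed

text \<open>
  Quantifying over the elements \<open>q\<close> below \<open>p\<close> turns the Boolean operations into the clauses of the
  forcing relation.  With this lemma for implication and the next one for suprema, inequalities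
  between Boolean values become first-order reasoning about conditions.
\<close>

lemma le_implication_iff:
  assumes [simp]: "a \<in> carrier L" "b \<in> carrier L" "p \<in> carrier L"
  shows "p \<sqsubseteq> bcompl L a \<squnion> b \<longleftrightarrow> (\<forall>q\<in>carrier L. q \<sqsubseteq> p \<longrightarrow> q \<sqsubseteq> a \<longrightarrow> q \<sqsubseteq> b)"
proof (intro iffI ballI impI)
  note [simp] = bcompl(1)
  fix q assume p: "p \<sqsubseteq> bcompl L a \<squnion> b" and [simp]: "q \<in> carrier L" and q: "q \<sqsubseteq> p" "q \<sqsubseteq> a"
  have "q \<sqsubseteq> bcompl L a \<squnion> b" by (rule le_trans[OF q(1) p]) auto
  then have "q = q \<sqinter> (bcompl L a \<squnion> b)"
    by (subst (asm) le_iff_join) auto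
  also have "\<dots> = (q \<sqinter> bcompl L a) \<squnion> (q \<sqinter> b)" by (simp add: meet_join_distrib)
  also have "\<dots> \<sqsubseteq> b"
  proof (rule join_le)
    have "q \<sqinter> bcompl L a \<sqsubseteq> a \<sqinter> bcompl L a"
      using le_trans[OF meet_left q(2)] by (simp add: le_meet_iff meet_right)
    then show "q \<sqinter> bcompl L a \<sqsubseteq> b"
      by (simp add: bcompl(2) le_bot_iff)
  qed (auto simp: meet_right)
  finally show "q \<sqsubseteq> b" .
next
  note [simp] = bcompl(1)
  assume imp: "\<forall>q\<in>carrier L. q \<sqsubseteq> p \<longrightarrow> q \<sqsubseteq> a \<longrightarrow> q \<sqsubseteq> b"
  have "p \<sqsubseteq> a \<squnion> bcompl L a" by (simp add: bcompl(3))
  then have "p = p \<sqinter> (a \<squnion> bcompl L a)" by (subst (asm) le_iff_join) auto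
  also have "\<dots> = (p \<sqinter> a) \<squnion> (p \<sqinter> bcompl L a)" by (simp add: meet_join_distrib)
  also have "\<dots> \<sqsubseteq> bcompl L a \<squnion> b"
  proof (rule join_le)
    have "p \<sqinter> a \<sqsubseteq> b" using imp by (simp add: meet_left meet_right)
    then show "p \<sqinter> a \<sqsubseteq> bcompl L a \<squnion> b"
      by (rule le_trans) (auto simp: join_right)
    show "p \<sqinter> bcompl L a \<sqsubseteq> bcompl L a \<squnion> b"
      by (rule le_trans[OF meet_right join_left]) auto
  qed auto
  finally show "p \<sqsubseteq> bcompl L a \<squnion> b" .
qed

text \<open>
  This is infinite distributivity in the form of an elimination rule: \<open>S\<close> is bounded by the
  implication from \<open>p\<close> to \<open>r\<close>.
\<close>

lemma le_SupE:
  assumes "p \<sqsubseteq> \<Squnion> S" "S \<subseteq> carrier L" "p \<in> carrier L" "r \<in> carrier L"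
    and step: "\<And>s q. \<lbrakk>s \<in> S; q \<in> carrier L; q \<sqsubseteq> p; q \<sqsubseteq> s\<rbrakk> \<Longrightarrow> q \<sqsubseteq> r"
  shows "p \<sqsubseteq> r"
proof -
  have "\<Squnion> S \<sqsubseteq> bcompl L p \<squnion> r"
  proof (rule sup_least)
    fix s assume "s \<in> S"
    then show "s \<sqsubseteq> bcompl L p \<squnion> r"
      using assms by (subst le_implication_iff) auto
  qed (use assms bcompl in auto)
  then have "p \<sqsubseteq> bcompl L p \<squnion> r"
    using assms by (meson bcompl(1) join_closed le_trans sup_closed)
  then show ?thesis using assms by (auto simp: le_implication_iff)
qed

lemma le_Sup: "\<lbrakk>s \<in> S; S \<subseteq> carrier L; p \<in> carrier L; p \<sqsubseteq> s\<rbrakk> \<Longrightarrow> p \<sqsubseteq> \<Squnion> S"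
  by (meson le_trans subsetD sup_closed sup_upper)

lemma le_Inf_iff:
  "\<lbrakk>S \<subseteq> carrier L; p \<in> carrier L\<rbrakk> \<Longrightarrow> p \<sqsubseteq> \<Sqinter> S \<longleftrightarrow> (\<forall>s\<in>S. p \<sqsubseteq> s)"
  by (meson inf_closed inf_greatest inf_lower le_trans subsetD)

lemma Sup_eq_top_of_maximal_antichain:
  assumes "maximal_antichain L A"
  shows "\<Squnion> A = \<top>"
proof -
  have A: "antichain L A" and max: "\<And>A'. antichain L A' \<Longrightarrow> A \<subseteq> A' \<Longrightarrow> A' = A"
    using assms by (auto simp: maximal_antichain_def)
  have AL: "A \<subseteq> carrier L" using A by (auto simp: antichain_def)
  let ?c = "bcompl L (\<Squnion> A)"
  have c: "?c \<in> carrier L" "\<Squnion> A \<sqinter> ?c = \<bottom>" "\<Squnion> A \<squnion> ?c = \<top>"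
    using AL by (auto intro!: bcompl)
  have disj: "a \<sqinter> ?c = \<bottom>" if "a \<in> A" for a
  proof -
    have a: "a \<in> carrier L" using that AL by blast
    have "a \<sqinter> ?c \<sqsubseteq> \<Squnion> A"
      by (rule le_trans[OF meet_left sup_upper]) (use a that AL c in auto)
    then have "a \<sqinter> ?c \<sqsubseteq> \<Squnion> A \<sqinter> ?c"
      using a AL c by (subst le_meet_iff) (auto intro: meet_right)
    then show ?thesis using that AL c by (auto simp: le_bot_iff)
  qed
  have "?c = \<bottom>"
  proof (rule ccontr)
    assume ne: "?c \<noteq> \<bottom>"
    have "antichain L (insert ?c A)"
      using A c ne disj AL unfolding antichain_def
      by (auto simp: meet_comm)
    then have "?c \<in> A" using max by blast
    with disj have "?c \<sqinter> ?c = \<bottom>" by blast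
    moreover have "?c \<sqsubseteq> ?c \<sqinter> ?c" using c by (simp add: le_meet_iff)
    ultimately show False using c ne by (simp add: le_bot_iff)
  qed
  with c AL have "\<Squnion> A \<squnion> \<bottom> = \<top>" by simp
  moreover have "\<Squnion> A \<squnion> \<bottom> \<sqsubseteq> \<Squnion> A"
    using AL by (intro join_le) auto
  ultimately show ?thesis using AL by (simp add: top_le_iff)
qed

lemma maximal_antichainI:
  assumes A: "antichain L A" and sup: "\<Squnion> A = \<top>"
  shows "maximal_antichain L A"
  unfolding maximal_antichain_def
proof (intro conjI allI impI A)
  fix A' assume A': "antichain L A' \<and> A \<subseteq> A'"
  have AL: "A \<subseteq> carrier L" using A by (auto simp: antichain_def)
  have "c \<in> A" if "c \<in> A'" for c
  proof (rule ccontr)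
    assume "c \<notin> A"
    with that A' have c: "c \<in> carrier L" "c \<noteq> \<bottom>" and disj: "\<And>a. a \<in> A \<Longrightarrow> a \<sqinter> c = \<bottom>"
      by (auto simp: antichain_def)
    have "c \<sqsubseteq> \<bottom>"
    proof (rule le_SupE[of c A])
      show "c \<sqsubseteq> \<Squnion> A" using c sup by simp
      fix s q assume s: "s \<in> A" "q \<in> carrier L" "q \<sqsubseteq> c" "q \<sqsubseteq> s"
      then have "q \<sqsubseteq> s \<sqinter> c" using c AL by (subst le_meet_iff) auto
      then show "q \<sqsubseteq> \<bottom>" using disj s by simp
    qed (use c AL in auto)
    with c show False by (simp add: le_bot_iff)
  qed
  with A' show "A' = A" by auto
qed

end

section \<open>Names and Boolean values\<close>

locale boolean_valued_universe = complete_boolean_algebra L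
  for L :: "'v::zfc_universe gorder" (structure) +
  assumes small_carrier: "small (carrier L)"
begin

text \<open>Building membership in the carrier into the order makes transitivity unconditional.\<close>

definition forces :: "'v \<Rightarrow> 'v \<Rightarrow> bool" (infix \<open>\<preceq>\<close> 50) where
  "p \<preceq> a \<longleftrightarrow> p \<in> carrier L \<and> a \<in> carrier L \<and> p \<sqsubseteq> a"

lemma forcesD: "p \<preceq> a \<Longrightarrow> p \<in> carrier L" "p \<preceq> a \<Longrightarrow> a \<in> carrier L"
  by (auto simp: forces_def)

lemma forces_refl: "p \<in> carrier L \<Longrightarrow> p \<preceq> p"
  by (simp add: forces_def)

lemma forces_trans: "q \<preceq> p \<Longrightarrow> p \<preceq> a \<Longrightarrow> q \<preceq> a"
  by (auto simp: forces_def intro: le_trans)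

lemma forces_bottom_iff: "p \<preceq> \<bottom> \<longleftrightarrow> p = \<bottom>"
  by (auto simp: forces_def le_bot_iff)

lemma bottom_forces: "a \<in> carrier L \<Longrightarrow> \<bottom> \<preceq> a"
  by (simp add: forces_def)

lemma forces_top: "p \<in> carrier L \<Longrightarrow> p \<preceq> \<top>"
  by (simp add: forces_def)

lemma forces_meet_iff:
  "\<lbrakk>a \<in> carrier L; b \<in> carrier L\<rbrakk> \<Longrightarrow> p \<preceq> a \<sqinter> b \<longleftrightarrow> p \<preceq> a \<and> p \<preceq> b"
  by (auto simp: forces_def le_meet_iff)

lemma forces_SupE:
  assumes "p \<preceq> \<Squnion> S" "S \<subseteq> carrier L" "r \<in> carrier L"
    and "\<And>s q. \<lbrakk>s \<in> S; q \<preceq> p; q \<preceq> s\<rbrakk> \<Longrightarrow> q \<preceq> r"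
  shows "p \<preceq> r"
proof -
  have "p \<in> carrier L" "p \<sqsubseteq> \<Squnion> S"
    using assms(1) by (auto simp: forces_def)
  moreover from this have "p \<sqsubseteq> r"
    using assms(2-4) by (intro le_SupE[of p S r]) (auto simp: forces_def subset_iff)
  ultimately show ?thesis using assms(3) by (simp add: forces_def)
qed

lemma forces_SupI: "\<lbrakk>s \<in> S; S \<subseteq> carrier L; p \<preceq> s\<rbrakk> \<Longrightarrow> p \<preceq> \<Squnion> S"
  by (auto simp: forces_def intro: le_Sup)

lemma forces_Inf_iff:
  "\<lbrakk>S \<subseteq> carrier L; p \<in> carrier L\<rbrakk> \<Longrightarrow> p \<preceq> \<Sqinter> S \<longleftrightarrow> (\<forall>s\<in>S. p \<preceq> s)"
  by (auto simp: forces_def le_Inf_iff)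

lemma forces_implication_iff:
  "\<lbrakk>a \<in> carrier L; b \<in> carrier L; p \<in> carrier L\<rbrakk> \<Longrightarrow>
     p \<preceq> bcompl L a \<squnion> b \<longleftrightarrow> (\<forall>q. q \<preceq> p \<longrightarrow> q \<preceq> a \<longrightarrow> q \<preceq> b)"
  using le_implication_iff[of a b p] by (auto simp: forces_def bcompl)

abbreviation "bn \<equiv> bname L"
abbreviation "bmem \<equiv> bv_mem L"
abbreviation "beq \<equiv> bv_eq L"
abbreviation "bsub \<equiv> bv_sub L"
abbreviation "chk \<equiv> check_name L"

lemma bname_memD:
  assumes "opair \<eta> b \<in>\<^sub>V \<tau>" "bn \<tau>"
  shows "bn \<eta>" "b \<in> carrier L"
proof -
  from assms(2) obtain "\<forall>p. p \<in>\<^sub>V \<tau> \<longrightarrow> (\<exists>\<sigma> b. p = opair \<sigma> b \<and> bn \<sigma> \<and> b \<in> carrier L)"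
    by cases
  with assms(1) show "bn \<eta>" "b \<in> carrier L" by auto
qed

lemma bname_induct [consumes 1, case_names name]:
  assumes "bn \<tau>"
    and "\<And>\<tau>. \<lbrakk>bn \<tau>; \<And>\<eta> b. opair \<eta> b \<in>\<^sub>V \<tau> \<Longrightarrow> P \<eta>\<rbrakk> \<Longrightarrow> P \<tau>"
  shows "P \<tau>"
  using assms(1)
proof (induction rule: bname.induct)
  case (1 \<tau>)
  then have "bn \<tau>" by (intro bname.intros) blast
  moreover have "P \<eta>" if "opair \<eta> b \<in>\<^sub>V \<tau>" for \<eta> b
    using 1 that by fastforce
  ultimately show ?case by (rule assms(2))
qed

text \<open>
  The recursion that defines the Boolean values carries the algebra as an argument, so the algebra
  has to be a variable in its induction rule; the premise \<open>L' = L\<close> fixes it again.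
\<close>

lemma boolean_value_closed_aux:
  "L' = L \<longrightarrow> bn \<tau> \<longrightarrow> bn \<sigma> \<longrightarrow> bv_mem L' \<tau> \<sigma> \<in> carrier L"
  "L' = L \<longrightarrow> bn \<tau> \<longrightarrow> bn \<sigma> \<longrightarrow> bv_eq L' \<tau> \<sigma> \<in> carrier L"
  "L' = L \<longrightarrow> bn \<tau> \<longrightarrow> bn \<sigma> \<longrightarrow> bv_sub L' \<tau> \<sigma> \<in> carrier L"
proof (induction L' \<tau> \<sigma> and L' \<tau> \<sigma> and L' \<tau> \<sigma> rule: bv_mem_bv_eq_bv_sub.induct)
  case (1 L' \<tau> \<sigma>)
  have "bv_eq L' \<tau> \<eta> \<sqinter> b \<in> carrier L"
    if "L' = L" "bn \<tau>" "bn \<sigma>" "opair \<eta> b \<in>\<^sub>V \<sigma>" for \<eta> b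
    using 1[of "(\<eta>, b)" \<eta> b] that bname_memD[of \<eta> b \<sigma>] by simp
  then show ?case
    by (auto simp: bv_mem.simps[of _ \<tau>] intro!: sup_closed)
next
  case (2 L' \<tau> \<sigma>)
  then show ?case by (auto simp: bv_eq.simps[of _ \<tau>])
next
  case (3 L' \<tau> \<sigma>)
  then show ?case
    by (auto simp: bv_sub.simps[of _ \<tau>] dest: bname_memD intro!: inf_closed join_closed bcompl)
qed

lemma boolean_value_closed [simp]:
  assumes "bn \<tau>" "bn \<sigma>"
  shows "bmem \<tau> \<sigma> \<in> carrier L" "beq \<tau> \<sigma> \<in> carrier L" "bsub \<tau> \<sigma> \<in> carrier L"
  using assms boolean_value_closed_aux by blast+

lemma forces_memI:
  assumes "bn \<tau>" "bn \<sigma>" "opair \<eta> b \<in>\<^sub>V \<sigma>" "p \<preceq> beq \<tau> \<eta>" "p \<preceq> b"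
  shows "p \<preceq> bmem \<tau> \<sigma>"
  unfolding bv_mem.simps[of L \<tau>]
proof (rule forces_SupI)
  show "beq \<tau> \<eta> \<sqinter> b \<in> (\<lambda>(\<eta>, b). beq \<tau> \<eta> \<sqinter> b) ` {(\<eta>, b). opair \<eta> b \<in>\<^sub>V \<sigma>}"
    using assms(3) by force
  show "(\<lambda>(\<eta>, b). beq \<tau> \<eta> \<sqinter> b) ` {(\<eta>, b). opair \<eta> b \<in>\<^sub>V \<sigma>} \<subseteq> carrier L"
    using assms(1,2) by (auto dest: bname_memD intro!: meet_closed)
  show "p \<preceq> beq \<tau> \<eta> \<sqinter> b"
    using assms by (subst forces_meet_iff) (auto dest: forcesD)
qed

lemma forces_memE:
  assumes "p \<preceq> bmem \<tau> \<sigma>" "bn \<tau>" "bn \<sigma>" "r \<in> carrier L"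
    and step: "\<And>\<eta> b q. \<lbrakk>opair \<eta> b \<in>\<^sub>V \<sigma>; bn \<eta>; q \<preceq> p; q \<preceq> beq \<tau> \<eta>; q \<preceq> b\<rbrakk> \<Longrightarrow> q \<preceq> r"
  shows "p \<preceq> r"
proof (rule forces_SupE)
  show "p \<preceq> \<Squnion> ((\<lambda>(\<eta>, b). beq \<tau> \<eta> \<sqinter> b) ` {(\<eta>, b). opair \<eta> b \<in>\<^sub>V \<sigma>})"
    using assms(1) by (simp only: bv_mem.simps[of L \<tau>])
  show "(\<lambda>(\<eta>, b). beq \<tau> \<eta> \<sqinter> b) ` {(\<eta>, b). opair \<eta> b \<in>\<^sub>V \<sigma>} \<subseteq> carrier L"
    using assms(2,3) by (auto dest: bname_memD intro!: meet_closed)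
  fix s q
  assume s: "s \<in> (\<lambda>(\<eta>, b). beq \<tau> \<eta> \<sqinter> b) ` {(\<eta>, b). opair \<eta> b \<in>\<^sub>V \<sigma>}" and q: "q \<preceq> p" "q \<preceq> s"
  then obtain \<eta> b where \<eta>: "opair \<eta> b \<in>\<^sub>V \<sigma>" "s = beq \<tau> \<eta> \<sqinter> b" by auto
  have "q \<preceq> beq \<tau> \<eta>" "q \<preceq> b"
    using \<eta> q assms(2,3) bname_memD[OF \<eta>(1) assms(3)] by (auto simp: forces_meet_iff)
  then show "q \<preceq> r"
    using step \<eta>(1) q(1) bname_memD[OF \<eta>(1) assms(3)] by blast
qed (rule assms)

lemma forces_sub_iff:
  assumes "bn \<tau>" "bn \<sigma>" "p \<in> carrier L"
  shows "p \<preceq> bsub \<tau> \<sigma> \<longleftrightarrow>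
    (\<forall>\<eta> b q. opair \<eta> b \<in>\<^sub>V \<tau> \<longrightarrow> q \<preceq> p \<longrightarrow> q \<preceq> bmem \<eta> \<tau> \<longrightarrow> q \<preceq> bmem \<eta> \<sigma>)"
proof -
  have *: "bmem \<eta> \<tau> \<in> carrier L" "bmem \<eta> \<sigma> \<in> carrier L" if "opair \<eta> b \<in>\<^sub>V \<tau>" for \<eta> b
    using assms bname_memD[OF that assms(1)] by auto
  have "p \<preceq> bsub \<tau> \<sigma> \<longleftrightarrow>
      (\<forall>\<eta>\<in>{\<eta>. \<exists>b. opair \<eta> b \<in>\<^sub>V \<tau>}. p \<preceq> bcompl L (bmem \<eta> \<tau>) \<squnion> bmem \<eta> \<sigma>)"
    unfolding bv_sub.simps[of L \<tau>]
    by (subst forces_Inf_iff) (use assms * in \<open>auto intro!: join_closed bcompl\<close>)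
  also have "\<dots> \<longleftrightarrow> (\<forall>\<eta> b q. opair \<eta> b \<in>\<^sub>V \<tau> \<longrightarrow> q \<preceq> p \<longrightarrow> q \<preceq> bmem \<eta> \<tau> \<longrightarrow> q \<preceq> bmem \<eta> \<sigma>)"
    using forces_implication_iff[OF * assms(3)] by blast
  finally show ?thesis .
qed

lemma forces_eq_iff:
  "\<lbrakk>bn \<tau>; bn \<sigma>\<rbrakk> \<Longrightarrow> p \<preceq> beq \<tau> \<sigma> \<longleftrightarrow> p \<preceq> bsub \<tau> \<sigma> \<and> p \<preceq> bsub \<sigma> \<tau>"
  by (simp add: bv_eq.simps[of L \<tau>] forces_meet_iff)

lemma beq_commute: "beq \<tau> \<sigma> = beq \<sigma> \<tau>"
  by (simp add: bv_eq.simps[of L] meet_comm)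

lemma forces_eq_refl: "\<lbrakk>bn \<tau>; p \<in> carrier L\<rbrakk> \<Longrightarrow> p \<preceq> beq \<tau> \<tau>"
  by (simp add: forces_eq_iff forces_sub_iff)

lemma forces_mem_of_pair:
  assumes "bn \<tau>" "opair \<eta> b \<in>\<^sub>V \<tau>" "p \<preceq> b"
  shows "p \<preceq> bmem \<eta> \<tau>"
  using assms bname_memD[OF assms(2,1)] forcesD[OF assms(3)]
  by (auto intro: forces_memI forces_eq_refl)

text \<open>
  Transitivity for \<open>\<rho>\<close>, \<open>\<eta>\<close>, \<open>\<zeta>\<close> reduces to transitivity for members of their domains: an element
  forced into \<open>\<rho>\<close> is forced equal to some element of \<open>\<eta>\<close>, which in turn is forced equal to some
  element of \<open>\<zeta>\<close>.  The converse inclusion needs the statement with the roles of \<open>\<rho>\<close> and \<open>\<zeta>\<close> exchanged,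
  but since equality is symmetric it is again an instance for an element of \<open>\<rho>\<close>, and induction on
  \<open>\<rho>\<close> alone suffices.
\<close>

lemma forces_eq_trans:
  assumes "bn \<rho>" "bn \<eta>" "bn \<zeta>" "p \<preceq> beq \<rho> \<eta>" "p \<preceq> beq \<eta> \<zeta>"
  shows "p \<preceq> beq \<rho> \<zeta>"
  using assms
proof (induction arbitrary: \<eta> \<zeta> p rule: bname_induct)
  case (name \<rho>)
  note names = \<open>bn \<rho>\<close> \<open>bn \<eta>\<close> \<open>bn \<zeta>\<close>
  have p: "p \<in> carrier L" using name.prems by (auto dest: forcesD)
  have sub: "p \<preceq> bsub \<rho> \<eta>" "p \<preceq> bsub \<eta> \<rho>" "p \<preceq> bsub \<eta> \<zeta>" "p \<preceq> bsub \<zeta> \<eta>"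
    using names name.prems by (auto simp: forces_eq_iff)
  have subD: "q \<preceq> bmem \<xi> \<sigma>"
    if "p \<preceq> bsub \<tau> \<sigma>" "opair \<xi> b \<in>\<^sub>V \<tau>" "bn \<tau>" "bn \<sigma>" "q \<preceq> p" "q \<preceq> bmem \<xi> \<tau>" for \<tau> \<sigma> \<xi> b q
    using that p by (auto simp: forces_sub_iff)
  have "p \<preceq> bsub \<rho> \<zeta>"
    unfolding forces_sub_iff[OF names(1,3) p]
  proof (intro allI impI)
    fix \<xi> b q assume \<xi>: "opair \<xi> b \<in>\<^sub>V \<rho>" and q: "q \<preceq> p" "q \<preceq> bmem \<xi> \<rho>"
    have n\<xi>: "bn \<xi>" using bname_memD names \<xi> by blast
    note r = boolean_value_closed(1)[OF n\<xi> names(3)]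
    show "q \<preceq> bmem \<xi> \<zeta>"
    proof (rule forces_memE[OF subD[OF sub(1) \<xi> names(1,2) q] n\<xi> names(2) r])
      fix \<theta> c q' assume \<theta>: "opair \<theta> c \<in>\<^sub>V \<eta>" "bn \<theta>" and q': "q' \<preceq> q" "q' \<preceq> beq \<xi> \<theta>" "q' \<preceq> c"
      have "q' \<preceq> bmem \<theta> \<zeta>"
        using subD[OF sub(3) \<theta>(1) names(2,3) forces_trans[OF q'(1) q(1)]]
          forces_mem_of_pair[OF names(2) \<theta>(1) q'(3)] by simp
      then show "q' \<preceq> bmem \<xi> \<zeta>"
      proof (rule forces_memE[OF _ \<theta>(2) names(3) r])
        fix \<kappa> d q'' assume \<kappa>: "opair \<kappa> d \<in>\<^sub>V \<zeta>" "bn \<kappa>" "q'' \<preceq> q'" "q'' \<preceq> beq \<theta> \<kappa>" "q'' \<preceq> d"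
        have "q'' \<preceq> beq \<xi> \<kappa>"
          by (rule name.IH[OF \<xi> \<theta>(2) \<kappa>(2) forces_trans[OF \<kappa>(3) q'(2)] \<kappa>(4)])
        then show "q'' \<preceq> bmem \<xi> \<zeta>"
          by (rule forces_memI[OF n\<xi> names(3) \<kappa>(1) _ \<kappa>(5)])
      qed
    qed
  qed
  moreover have "p \<preceq> bsub \<zeta> \<rho>"
    unfolding forces_sub_iff[OF names(3,1) p]
  proof (intro allI impI)
    fix \<kappa> b q assume \<kappa>: "opair \<kappa> b \<in>\<^sub>V \<zeta>" and q: "q \<preceq> p" "q \<preceq> bmem \<kappa> \<zeta>"
    have n\<kappa>: "bn \<kappa>" using bname_memD names \<kappa> by blast
    note r = boolean_value_closed(1)[OF n\<kappa> names(1)]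
    show "q \<preceq> bmem \<kappa> \<rho>"
    proof (rule forces_memE[OF subD[OF sub(4) \<kappa> names(3,2) q] n\<kappa> names(2) r])
      fix \<theta> c q' assume \<theta>: "opair \<theta> c \<in>\<^sub>V \<eta>" "bn \<theta>" and q': "q' \<preceq> q" "q' \<preceq> beq \<kappa> \<theta>" "q' \<preceq> c"
      have "q' \<preceq> bmem \<theta> \<rho>"
        using subD[OF sub(2) \<theta>(1) names(2,1) forces_trans[OF q'(1) q(1)]]
          forces_mem_of_pair[OF names(2) \<theta>(1) q'(3)] by simp
      then show "q' \<preceq> bmem \<kappa> \<rho>"
      proof (rule forces_memE[OF _ \<theta>(2) names(1) r])
        fix \<xi> d q'' assume \<xi>: "opair \<xi> d \<in>\<^sub>V \<rho>" "bn \<xi>" "q'' \<preceq> q'" "q'' \<preceq> beq \<theta> \<xi>" "q'' \<preceq> d"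
        have "q'' \<preceq> beq \<theta> \<kappa>"
          using forces_trans[OF \<xi>(3) q'(2)] by (simp only: beq_commute)
        with \<xi>(4) have "q'' \<preceq> beq \<xi> \<kappa>"
          by (intro name.IH[OF \<xi>(1) \<theta>(2) n\<kappa>]) (simp_all only: beq_commute)
        then show "q'' \<preceq> bmem \<kappa> \<rho>"
          by (intro forces_memI[OF n\<kappa> names(1) \<xi>(1) _ \<xi>(5)]) (simp only: beq_commute)
      qed
    qed
  qed
  ultimately show ?case using names by (simp add: forces_eq_iff)
qed

lemma forces_mem_cong_left:
  assumes "bn \<rho>" "bn \<eta>" "bn \<sigma>" "p \<preceq> beq \<rho> \<eta>" "p \<preceq> bmem \<eta> \<sigma>"
  shows "p \<preceq> bmem \<rho> \<sigma>"
proof (rule forces_memE[OF assms(5,2,3)])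
  fix \<zeta> b q assume \<zeta>: "opair \<zeta> b \<in>\<^sub>V \<sigma>" "bn \<zeta>" "q \<preceq> p" "q \<preceq> beq \<eta> \<zeta>" "q \<preceq> b"
  have "q \<preceq> beq \<rho> \<zeta>"
    by (rule forces_eq_trans[OF assms(1,2) \<zeta>(2) forces_trans[OF \<zeta>(3) assms(4)] \<zeta>(4)])
  then show "q \<preceq> bmem \<rho> \<sigma>"
    by (rule forces_memI[OF assms(1,3) \<zeta>(1) _ \<zeta>(5)])
qed (use assms in simp)

lemma forces_mem_cong_right:
  assumes "bn \<rho>" "bn \<tau>" "bn \<sigma>" "p \<preceq> beq \<tau> \<sigma>" "p \<preceq> bmem \<rho> \<tau>"
  shows "p \<preceq> bmem \<rho> \<sigma>"
proof (rule forces_memE[OF assms(5,1,2)])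
  fix \<eta> b q assume \<eta>: "opair \<eta> b \<in>\<^sub>V \<tau>" "bn \<eta>" "q \<preceq> p" "q \<preceq> beq \<rho> \<eta>" "q \<preceq> b"
  have "p \<preceq> bsub \<tau> \<sigma>" using assms by (simp add: forces_eq_iff)
  then have "q \<preceq> bmem \<eta> \<sigma>"
    using \<eta> assms forces_mem_of_pair[OF assms(2) \<eta>(1,5)] forcesD[OF assms(5)]
    by (auto simp: forces_sub_iff)
  with \<eta> assms show "q \<preceq> bmem \<rho> \<sigma>" by (intro forces_mem_cong_left[of \<rho> \<eta> \<sigma> q])
qed (use assms in simp)

lemma opair_in_check_iff: "opair \<eta> b \<in>\<^sub>V chk x \<longleftrightarrow> (\<exists>y. y \<in>\<^sub>V x \<and> \<eta> = chk y \<and> b = \<top>)"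
  by (auto simp: check_name.simps[of L x] vmem_iff_elts elts_vset_small small_image)

lemma bname_check [simp]: "bn (chk x)"
proof (induction x rule: wf_induct_rule[OF foundation])
  case (1 x)
  show ?case
  proof (rule bname.intros, intro allI impI)
    fix p assume "p \<in>\<^sub>V chk x"
    then obtain y where "p = opair (chk y) \<top>" "y \<in>\<^sub>V x"
      by (auto simp: check_name.simps[of L x] vmem_iff_elts elts_vset_small small_image)
    with 1 show "\<exists>\<sigma> b. p = opair \<sigma> b \<and> bn \<sigma> \<and> b \<in> carrier L" by auto
  qed
qed

lemma forces_check_mem: "\<lbrakk>y \<in>\<^sub>V x; p \<in> carrier L\<rbrakk> \<Longrightarrow> p \<preceq> bmem (chk y) (chk x)"
  by (rule forces_mem_of_pair[of _ _ \<top>]) (auto simp: opair_in_check_iff forces_top)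

text \<open>
  An element \<open>z\<close> of only one of the two sets would be forced equal to an element \<open>w \<noteq> z\<close> of the
  other, and one of \<open>z\<close> and \<open>w\<close> belongs to \<open>x\<close>; hence the induction on \<open>x\<close>.
\<close>

lemma forces_check_eqD:
  assumes "p \<preceq> beq (chk x) (chk y)" "x \<noteq> y"
  shows "p = \<bottom>"
  using assms
proof (induction x arbitrary: y p rule: wf_induct_rule[OF foundation])
  case (1 x)
  have sub: "p \<preceq> bmem (chk z) (chk y)" if "z \<in>\<^sub>V x" for z
    by (rule forces_mem_cong_right[of _ "chk x"])
      (use 1 that in \<open>auto intro: forces_check_mem dest: forcesD\<close>)
  have sup: "p \<preceq> bmem (chk w) (chk x)" if "w \<in>\<^sub>V y" for w
    by (rule forces_mem_cong_right[of _ "chk y"])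
      (use 1 that in \<open>auto intro: forces_check_mem dest: forcesD simp: beq_commute\<close>)
  obtain z where "z \<in>\<^sub>V x \<and> \<not> z \<in>\<^sub>V y \<or> z \<in>\<^sub>V y \<and> \<not> z \<in>\<^sub>V x"
    using 1(3) extensionality by blast
  then have "p \<preceq> \<bottom>"
  proof
    assume z: "z \<in>\<^sub>V x \<and> \<not> z \<in>\<^sub>V y"
    show "p \<preceq> \<bottom>"
    proof (rule forces_memE[OF sub[of z]])
      fix \<eta> b q assume "opair \<eta> b \<in>\<^sub>V chk y" "q \<preceq> beq (chk z) \<eta>"
      then obtain w where "w \<in>\<^sub>V y" "q \<preceq> beq (chk z) (chk w)"
        by (auto simp: opair_in_check_iff)
      with z 1(1)[of z q w] show "q \<preceq> \<bottom>" by (auto simp: forces_bottom_iff)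
    qed (use z in auto)
  next
    assume z: "z \<in>\<^sub>V y \<and> \<not> z \<in>\<^sub>V x"
    show "p \<preceq> \<bottom>"
    proof (rule forces_memE[OF sup[of z]])
      fix \<eta> b q assume "opair \<eta> b \<in>\<^sub>V chk x" "q \<preceq> beq (chk z) \<eta>"
      then obtain w where "w \<in>\<^sub>V x" "q \<preceq> beq (chk w) (chk z)"
        by (auto simp: opair_in_check_iff beq_commute)
      with z 1(1)[of w q z] show "q \<preceq> \<bottom>" by (auto simp: forces_bottom_iff)
    qed (use z in auto)
  qed
  then show ?case by (simp add: forces_bottom_iff)
qed

lemma forces_eq_check_unique:
  assumes "bn \<tau>" "p \<preceq> beq \<tau> (chk x)" "p \<preceq> beq \<tau> (chk y)" "x \<noteq> y"
  shows "p = \<bottom>"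
proof -
  have "p \<preceq> beq (chk x) (chk y)"
    by (rule forces_eq_trans[of _ \<tau>]) (use assms in \<open>auto simp: beq_commute\<close>)
  then show ?thesis using assms forces_check_eqD by blast
qed

lemma forces_check_memD:
  assumes "p \<preceq> bmem (chk x) (chk y)" "\<not> x \<in>\<^sub>V y"
  shows "p = \<bottom>"
proof -
  have "p \<preceq> \<bottom>"
  proof (rule forces_memE[OF assms(1)])
    fix \<eta> b q assume "opair \<eta> b \<in>\<^sub>V chk y" "q \<preceq> beq (chk x) \<eta>"
    then obtain w where "w \<in>\<^sub>V y" "q \<preceq> beq (chk x) (chk w)"
      by (auto simp: opair_in_check_iff)
    with assms(2) forces_check_eqD[of q x w] show "q \<preceq> \<bottom>" by (auto simp: forces_bottom_iff)
  qed auto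
  then show ?thesis by (simp add: forces_bottom_iff)
qed

lemma opair_in_generic_name_iff:
  "opair \<eta> b \<in>\<^sub>V generic_name L \<longleftrightarrow> b \<in> carrier L \<and> \<eta> = chk b"
  by (auto simp: generic_name_def vmem_iff_elts elts_vset_small small_image small_carrier)

lemma bname_generic_name [simp]: "bn (generic_name L)"
  by (rule bname.intros)
    (auto simp: generic_name_def vmem_iff_elts elts_vset_small small_image small_carrier)

text \<open>
  Given pairwise incompatible elements \<open>a i\<close> and arbitrary sets \<open>h i\<close> there is a single name which is
  forced by each \<open>a i\<close> to be the check name of \<open>h i\<close>: put \<open>y\<^sup>\<or>\<close> into it with value \<open>a i\<close> for each
  \<open>y \<in> h i\<close>.  The index type is arbitrary, and indices with \<open>a i = \<bottom>\<close> may well form a proper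
  class; they are discarded from the name, which makes it a set because the
  remaining indices are determined by the elements \<open>a i\<close> of the algebra.
\<close>

lemma mixing:
  fixes a h :: "'i \<Rightarrow> 'v"
  assumes a: "\<And>i. i \<in> I \<Longrightarrow> a i \<in> carrier L"
    and disjoint: "\<And>i j p. \<lbrakk>i \<in> I; j \<in> I; i \<noteq> j; p \<preceq> a i; p \<preceq> a j\<rbrakk> \<Longrightarrow> p = \<bottom>"
  shows "\<exists>\<sigma>. bn \<sigma> \<and> (\<forall>i\<in>I. a i \<preceq> beq \<sigma> (chk (h i)))"
proof -
  define S where "S = (\<Union>i\<in>{i\<in>I. a i \<noteq> \<bottom>}. (\<lambda>y. opair (chk y) (a i)) ` elts (h i))"
  define ix where "ix b = (SOME i. i \<in> I \<and> a i = b)" for b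
  have ix: "ix (a i) = i" if "i \<in> I" "a i \<noteq> \<bottom>" for i
  proof -
    have "ix (a i) \<in> I \<and> a (ix (a i)) = a i"
      unfolding ix_def by (rule someI[of _ i]) (use that in auto)
    with disjoint[of i "ix (a i)" "a i"] that a show ?thesis
      by (metis forces_refl)
  qed
  have "small S"
  proof (rule small_subset)
    show "small (\<Union>b\<in>carrier L. (\<lambda>y. opair (chk y) b) ` elts (h (ix b)))"
      by (intro small_UN small_image small_carrier small_elts)
    show "S \<subseteq> (\<Union>b\<in>carrier L. (\<lambda>y. opair (chk y) b) ` elts (h (ix b)))"
      using a ix unfolding S_def by force
  qed
  define \<sigma> where "\<sigma> = vset S"
  with \<open>small S\<close> have elts_\<sigma>: "elts \<sigma> = S" by (simp add: elts_vset_small)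
  have mem: "opair \<eta> b \<in>\<^sub>V \<sigma> \<longleftrightarrow> (\<exists>i y. i \<in> I \<and> a i \<noteq> \<bottom> \<and> y \<in>\<^sub>V h i \<and> \<eta> = chk y \<and> b = a i)" for \<eta> b
    unfolding vmem_iff_elts elts_\<sigma> by (simp add: S_def image_iff) blast
  have name: "bn \<sigma>"
    by (rule bname.intros) (use a in \<open>auto simp: vmem_iff_elts elts_\<sigma> S_def\<close>)
  have "a i \<preceq> beq \<sigma> (chk (h i))" if i: "i \<in> I" for i
  proof (cases "a i = \<bottom>")
    case True
    then show ?thesis using name by (auto intro: bottom_forces)
  next
    case False
    have "a i \<preceq> bsub \<sigma> (chk (h i))"
      unfolding forces_sub_iff[OF name bname_check a[OF i]]
    proof (intro allI impI)
      fix \<eta> b q assume \<eta>: "opair \<eta> b \<in>\<^sub>V \<sigma>" and q: "q \<preceq> a i" "q \<preceq> bmem \<eta> \<sigma>"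
      obtain y where y: "\<eta> = chk y" using \<eta> mem by blast
      show "q \<preceq> bmem \<eta> (chk (h i))"
        unfolding y
      proof (rule forces_memE[OF q(2)[unfolded y] bname_check name])
        fix \<zeta> c q' assume \<zeta>: "opair \<zeta> c \<in>\<^sub>V \<sigma>" and q': "q' \<preceq> q" "q' \<preceq> beq (chk y) \<zeta>" "q' \<preceq> c"
        obtain j z where j: "j \<in> I" "z \<in>\<^sub>V h j" "\<zeta> = chk z" "c = a j"
          using \<zeta> mem by blast
        show "q' \<preceq> bmem (chk y) (chk (h i))"
        proof (cases "q' = \<bottom>")
          case True
          then show ?thesis by (auto intro: bottom_forces)
        next
          case False
          then have "y = z" using q' j forces_check_eqD by blast
          moreover have "i = j"
            using disjoint[OF i j(1) _ forces_trans[OF q'(1) q(1)]] False q'(3) j(4) by auto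
          ultimately show ?thesis using j q' by (auto intro: forces_check_mem dest: forcesD)
        qed
      qed auto
    qed
    moreover have "a i \<preceq> bsub (chk (h i)) \<sigma>"
      unfolding forces_sub_iff[OF bname_check name a[OF i]]
    proof (intro allI impI)
      fix \<eta> b q assume "opair \<eta> b \<in>\<^sub>V chk (h i)" "q \<preceq> a i"
      with False i show "q \<preceq> bmem \<eta> \<sigma>"
        by (intro forces_mem_of_pair[OF name, of _ "a i"]) (auto simp: mem opair_in_check_iff)
    qed
    ultimately show ?thesis using name by (simp add: forces_eq_iff)
  qed
  with name show ?thesis by blast
qed

end

section \<open>Classes of names modulo the ultrafilter\<close>

locale boolean_ultrapower_universe = boolean_valued_universe L
  for L :: "'v::zfc_universe gorder" (structure) +
  fixes U :: "'v set"
  assumes ultrafilter: "ultrafilter_on L U"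
begin

lemma U_carrier: "a \<in> U \<Longrightarrow> a \<in> carrier L"
  using ultrafilter by (auto simp: ultrafilter_on_def)

lemma bottom_notin_U: "\<bottom> \<notin> U"
  using ultrafilter by (auto simp: ultrafilter_on_def)

lemma top_in_U: "\<top> \<in> U"
  using ultrafilter by (auto simp: ultrafilter_on_def)

lemma U_upward: "\<lbrakk>p \<in> U; p \<preceq> a\<rbrakk> \<Longrightarrow> a \<in> U"
  using ultrafilter by (auto simp: ultrafilter_on_def forces_def)

lemma U_meet: "\<lbrakk>a \<in> U; b \<in> U\<rbrakk> \<Longrightarrow> a \<sqinter> b \<in> U"
  using ultrafilter by (auto simp: ultrafilter_on_def)

lemma U_upward2:
  assumes "a \<in> U" "b \<in> U" "r \<in> carrier L"
    and "\<And>p. \<lbrakk>p \<preceq> a; p \<preceq> b\<rbrakk> \<Longrightarrow> p \<preceq> r"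
  shows "r \<in> U"
proof (rule U_upward[OF U_meet[OF assms(1,2)]])
  have "a \<in> carrier L" "b \<in> carrier L" using assms U_carrier by auto
  then show "a \<sqinter> b \<preceq> r"
    by (intro assms(4)) (auto simp: forces_def meet_left meet_right)
qed

lemma U_incompatible:
  assumes "a \<in> U" "b \<in> U" "\<And>p. \<lbrakk>p \<preceq> a; p \<preceq> b\<rbrakk> \<Longrightarrow> p = \<bottom>"
  shows False
proof -
  have "\<bottom> \<in> U"
    by (rule U_upward2[OF assms(1,2) bottom_closed], subst forces_bottom_iff, rule assms(3))
  with bottom_notin_U show False ..
qed

abbreviation "M \<equiv> boolean_ultrapower L U"
abbreviation "E \<equiv> umem L U"
abbreviation "cls \<equiv> ucls L U"

lemma eq_in_U_trans:
  "\<lbrakk>bn \<rho>; bn \<eta>; bn \<zeta>; beq \<rho> \<eta> \<in> U; beq \<eta> \<zeta> \<in> U\<rbrakk> \<Longrightarrow> beq \<rho> \<zeta> \<in> U"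
  by (rule U_upward2[of "beq \<rho> \<eta>" "beq \<eta> \<zeta>"]) (auto intro: forces_eq_trans)

lemma eq_in_U_refl: "bn \<tau> \<Longrightarrow> beq \<tau> \<tau> \<in> U"
  by (rule U_upward[OF top_in_U]) (simp add: forces_eq_refl)

lemma in_cls_iff:
  "\<sigma> \<in> cls \<tau> \<longleftrightarrow> bn \<sigma> \<and> beq \<sigma> \<tau> \<in> U \<and>
     (\<forall>\<rho>. bn \<rho> \<and> beq \<rho> \<tau> \<in> U \<longrightarrow> \<not> vrank \<rho> \<in>\<^sub>V vrank \<sigma>)"
  by (simp add: ucls_def)

lemma in_clsD:
  assumes "\<sigma> \<in> cls \<tau>"
  shows "bn \<sigma>" "beq \<sigma> \<tau> \<in> U" "beq \<tau> \<sigma> \<in> U"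
  using assms beq_commute[of \<sigma> \<tau>] by (simp_all add: in_cls_iff)

text \<open>Names of minimal rank exist because the values of \<open>vrank\<close> are well-founded under membership.\<close>

lemma cls_nonempty:
  assumes "bn \<tau>"
  obtains \<sigma> where "\<sigma> \<in> cls \<tau>"
proof -
  have "wf (inv_image {(x, y). x \<in>\<^sub>V y} vrank :: ('v \<times> 'v) set)"
    by (intro wf_inv_image foundation)
  moreover have "\<tau> \<in> {\<rho>. bn \<rho> \<and> beq \<rho> \<tau> \<in> U}"
    using assms eq_in_U_refl by simp
  ultimately obtain \<sigma> where "\<sigma> \<in> {\<rho>. bn \<rho> \<and> beq \<rho> \<tau> \<in> U}"
    "\<And>\<rho>. (\<rho>, \<sigma>) \<in> inv_image {(x, y). x \<in>\<^sub>V y} vrank \<Longrightarrow> \<rho> \<notin> {\<rho>. bn \<rho> \<and> beq \<rho> \<tau> \<in> U}"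
    by (rule wfE_min) blast
  then show ?thesis by (intro that[of \<sigma>]) (auto simp: in_cls_iff)
qed

lemma cls_eq_iff:
  assumes "bn \<tau>" "bn \<sigma>"
  shows "cls \<tau> = cls \<sigma> \<longleftrightarrow> beq \<tau> \<sigma> \<in> U"
proof
  assume eq: "cls \<tau> = cls \<sigma>"
  obtain \<rho> where "\<rho> \<in> cls \<tau>" using cls_nonempty assms by blast
  moreover from this eq have "\<rho> \<in> cls \<sigma>" by simp
  ultimately have "bn \<rho>" "beq \<tau> \<rho> \<in> U" "beq \<rho> \<sigma> \<in> U"
    by (auto dest: in_clsD)
  with assms show "beq \<tau> \<sigma> \<in> U" by (blast intro: eq_in_U_trans)
next
  assume eq: "beq \<tau> \<sigma> \<in> U"
  have "beq \<rho> \<tau> \<in> U \<longleftrightarrow> beq \<rho> \<sigma> \<in> U" if "bn \<rho>" for \<rho>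
    using eq_in_U_trans[OF that assms] eq_in_U_trans[OF that assms(2,1)] eq
    by (auto simp: beq_commute)
  then show "cls \<tau> = cls \<sigma>" by (auto simp: in_cls_iff)
qed

lemma umem_cls_iff:
  assumes "bn \<tau>" "bn \<sigma>"
  shows "E (cls \<tau>) (cls \<sigma>) \<longleftrightarrow> bmem \<tau> \<sigma> \<in> U"
proof -
  \<comment> \<open>Membership of a class is witnessed by representatives of minimal rank, which need not be \<open>\<tau>\<close> and \<open>\<sigma>\<close>.\<close>
  have transport: "bmem \<tau>' \<sigma>' \<in> U"
    if "bn \<tau>" "bn \<sigma>" "bn \<tau>'" "bn \<sigma>'" "beq \<tau>' \<tau> \<in> U" "beq \<sigma> \<sigma>' \<in> U" "bmem \<tau> \<sigma> \<in> U" for \<tau> \<sigma> \<tau>' \<sigma>'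
  proof -
    have "bmem \<tau>' \<sigma> \<in> U"
      by (rule U_upward2[OF that(5,7)]) (use that in \<open>auto intro: forces_mem_cong_left\<close>)
    then show ?thesis
      by (rule U_upward2[OF that(6)]) (use that in \<open>auto intro: forces_mem_cong_right\<close>)
  qed
  obtain \<tau>0 \<sigma>0 where 0: "\<tau>0 \<in> cls \<tau>" "\<sigma>0 \<in> cls \<sigma>"
    using cls_nonempty assms by metis
  show ?thesis
  proof
    assume "E (cls \<tau>) (cls \<sigma>)"
    then obtain \<tau>' \<sigma>' where "\<tau>' \<in> cls \<tau>" "\<sigma>' \<in> cls \<sigma>" "bmem \<tau>' \<sigma>' \<in> U"
      by (auto simp: umem_def)
    then show "bmem \<tau> \<sigma> \<in> U"
      using assms by - (rule transport[of \<tau>' \<sigma>'], auto dest: in_clsD)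
  next
    assume "bmem \<tau> \<sigma> \<in> U"
    then have "bmem \<tau>0 \<sigma>0 \<in> U"
      using 0 assms by - (rule transport[of \<tau> \<sigma>], auto dest: in_clsD)
    with 0 show "E (cls \<tau>) (cls \<sigma>)" by (auto simp: umem_def)
  qed
qed

section \<open>Ground names as random variables\<close>

text \<open>The Boolean value of the statement that \<open>\<tau>\<close> is some \<open>x\<^sup>\<or>\<close> with \<open>P x\<close>.\<close>

definition value_in :: "'v \<Rightarrow> ('v \<Rightarrow> bool) \<Rightarrow> 'v" where
  "value_in \<tau> P = \<Squnion> ((\<lambda>x. beq \<tau> (chk x)) ` Collect P)"

definition ground_name :: "'v \<Rightarrow> bool" where
  "ground_name \<tau> \<longleftrightarrow> bn \<tau> \<and> bv_ground L \<tau> \<in> U"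

lemma ground_nameD: "ground_name \<tau> \<Longrightarrow> bn \<tau>"
  by (simp add: ground_name_def)

lemma bv_ground_eq_value_in: "bv_ground L \<tau> = value_in \<tau> (\<lambda>_. True)"
  by (simp add: bv_ground_def value_in_def)

lemma in_boolean_ultrapower_iff: "X \<in> M \<longleftrightarrow> (\<exists>\<tau>. ground_name \<tau> \<and> X = cls \<tau>)"
  by (auto simp: boolean_ultrapower_def ground_name_def)

lemma value_in_closed [simp]: "bn \<tau> \<Longrightarrow> value_in \<tau> P \<in> carrier L"
  unfolding value_in_def by (rule sup_closed) auto

lemma forces_value_inI: "\<lbrakk>bn \<tau>; P x; p \<preceq> beq \<tau> (chk x)\<rbrakk> \<Longrightarrow> p \<preceq> value_in \<tau> P"
  unfolding value_in_def by (rule forces_SupI[of "beq \<tau> (chk x)"]) auto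

lemma forces_value_inE:
  assumes "p \<preceq> value_in \<tau> P" "bn \<tau>" "r \<in> carrier L"
    and "\<And>x q. \<lbrakk>P x; q \<preceq> p; q \<preceq> beq \<tau> (chk x)\<rbrakk> \<Longrightarrow> q \<preceq> r"
  shows "p \<preceq> r"
  using assms(1) unfolding value_in_def by (rule forces_SupE) (use assms in auto)

text \<open>
  The law of a ground name is an ultrafilter on the type of all sets, that is, an ultrafilter of
  classes of \<open>V\<close>.
\<close>

definition law :: "'v \<Rightarrow> 'v filter" where
  "law \<tau> = Abs_filter (\<lambda>P. value_in \<tau> P \<in> U)"

lemma eventually_law:
  assumes "ground_name \<tau>"
  shows "eventually P (law \<tau>) \<longleftrightarrow> value_in \<tau> P \<in> U"
  unfolding law_def
proof (rule eventually_Abs_filter, unfold_locales)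
  note [simp] = ground_nameD[OF assms]
  show "value_in \<tau> (\<lambda>_. True) \<in> U"
    using assms by (simp add: ground_name_def bv_ground_eq_value_in)
  show "value_in \<tau> (\<lambda>x. P x \<and> Q x) \<in> U" if "value_in \<tau> P \<in> U" "value_in \<tau> Q \<in> U" for P Q
  proof (rule U_upward2[OF that])
    fix p assume p: "p \<preceq> value_in \<tau> P" "p \<preceq> value_in \<tau> Q"
    show "p \<preceq> value_in \<tau> (\<lambda>x. P x \<and> Q x)"
    proof (rule forces_value_inE[OF p(1)])
      fix x q assume x: "P x" "q \<preceq> p" "q \<preceq> beq \<tau> (chk x)"
      show "q \<preceq> value_in \<tau> (\<lambda>x. P x \<and> Q x)"
      proof (rule forces_value_inE[OF forces_trans[OF x(2) p(2)]])
        fix y q' assume y: "Q y" "q' \<preceq> q" "q' \<preceq> beq \<tau> (chk y)"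
        have q': "q' \<preceq> beq \<tau> (chk x)" by (rule forces_trans[OF y(2) x(3)])
        show "q' \<preceq> value_in \<tau> (\<lambda>x. P x \<and> Q x)"
        proof (cases "x = y")
          case True
          with x y show ?thesis by (intro forces_value_inI[of _ _ y]) auto
        next
          case False
          then have "q' = \<bottom>" using forces_eq_check_unique[OF _ q' y(3)] by simp
          then show ?thesis by (simp add: bottom_forces)
        qed
      qed auto
    qed auto
  qed auto
  show "value_in \<tau> Q \<in> U" if "\<forall>x. P x \<longrightarrow> Q x" "value_in \<tau> P \<in> U" for P Q
  proof (rule U_upward[OF that(2)], rule forces_value_inE)
    show "value_in \<tau> P \<preceq> value_in \<tau> P" by (rule forces_refl) simp
  qed (use that in \<open>auto intro: forces_value_inI\<close>)
qed

text \<open>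
  The next lemma and \<open>eventually_lawI\<close> below translate between the law of \<open>\<tau>\<close> and \<open>U\<close>: it is
  enough to compare with the conditions that decide the value of \<open>\<tau>\<close>.
\<close>

lemma eventually_lawD:
  assumes "ground_name \<tau>" "eventually P (law \<tau>)" "r \<in> carrier L"
    and "\<And>x p. \<lbrakk>P x; p \<preceq> beq \<tau> (chk x)\<rbrakk> \<Longrightarrow> p \<preceq> r"
  shows "r \<in> U"
proof (rule U_upward)
  show "value_in \<tau> P \<in> U" using assms by (simp add: eventually_law)
  then show "value_in \<tau> P \<preceq> r"
    by (intro forces_value_inE[OF forces_refl])
      (use assms ground_nameD in \<open>auto intro: U_carrier\<close>)
qed

lemma eventually_law_not_iff:
  assumes "ground_name \<tau>"
  shows "eventually (\<lambda>x. \<not> P x) (law \<tau>) \<longleftrightarrow> \<not> eventually P (law \<tau>)"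
proof
  note [simp] = ground_nameD[OF assms]
  show "\<not> eventually P (law \<tau>)" if "eventually (\<lambda>x. \<not> P x) (law \<tau>)"
  proof
    assume "eventually P (law \<tau>)"
    with that have "eventually (\<lambda>x. False) (law \<tau>)" by eventually_elim simp
    then have "\<bottom> \<in> U" by (rule eventually_lawD[OF assms]) auto
    with bottom_notin_U show False by simp
  qed
  show "eventually (\<lambda>x. \<not> P x) (law \<tau>)" if "\<not> eventually P (law \<tau>)"
  proof -
    have "bcompl L (value_in \<tau> P) \<in> U"
      using that assms ultrafilter by (auto simp: eventually_law ultrafilter_on_def)
    moreover have "value_in \<tau> (\<lambda>_. True) \<in> U"
      using assms by (simp add: ground_name_def bv_ground_eq_value_in)
    ultimately have "value_in \<tau> (\<lambda>x. \<not> P x) \<in> U"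
    proof (rule U_upward2)
      fix p assume p: "p \<preceq> bcompl L (value_in \<tau> P)" "p \<preceq> value_in \<tau> (\<lambda>_. True)"
      show "p \<preceq> value_in \<tau> (\<lambda>x. \<not> P x)"
      proof (rule forces_value_inE[OF p(2)])
        fix x q assume x: "q \<preceq> p" "q \<preceq> beq \<tau> (chk x)"
        show "q \<preceq> value_in \<tau> (\<lambda>x. \<not> P x)"
        proof (cases "P x")
          case True
          then have "q \<preceq> value_in \<tau> P" using x by (auto intro: forces_value_inI)
          moreover have "q \<preceq> bcompl L (value_in \<tau> P)" using forces_trans x p by blast
          ultimately have "q \<preceq> value_in \<tau> P \<sqinter> bcompl L (value_in \<tau> P)"
            by (simp add: forces_meet_iff bcompl(1))
          then have "q = \<bottom>" by (simp add: bcompl(2) forces_bottom_iff)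
          then show ?thesis by (simp add: bottom_forces)
        qed (use x in \<open>auto intro: forces_value_inI\<close>)
      qed auto
    qed auto
    with assms show ?thesis by (simp add: eventually_law)
  qed
qed

lemma eventually_lawI:
  assumes "ground_name \<tau>" "r \<in> U"
    and "\<And>x p. \<lbrakk>\<not> P x; p \<preceq> beq \<tau> (chk x); p \<preceq> r\<rbrakk> \<Longrightarrow> p = \<bottom>"
  shows "eventually P (law \<tau>)"
proof (rule ccontr)
  assume "\<not> eventually P (law \<tau>)"
  then have "eventually (\<lambda>x. \<not> P x) (law \<tau>)"
    by (simp add: eventually_law_not_iff[OF assms(1)])
  then have "value_in \<tau> (\<lambda>x. \<not> P x) \<in> U"
    by (simp only: eventually_law[OF assms(1)])
  then show False
  proof (rule U_incompatible[OF _ assms(2)])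
    fix p assume p: "p \<preceq> value_in \<tau> (\<lambda>x. \<not> P x)" "p \<preceq> r"
    have "p \<preceq> \<bottom>"
    proof (rule forces_value_inE[OF p(1) ground_nameD[OF assms(1)] bottom_closed])
      fix x q assume "\<not> P x" "q \<preceq> p" "q \<preceq> beq \<tau> (chk x)"
      then have "q = \<bottom>" using forces_trans[OF _ p(2)] by (intro assms(3))
      then show "q \<preceq> \<bottom>" by (simp add: forces_bottom_iff)
    qed
    then show "p = \<bottom>" by (simp add: forces_bottom_iff)
  qed
qed

text \<open>A name for \<open>g(\<tau>)\<close>, obtained from the mixing lemma.\<close>

definition image_name :: "'v \<Rightarrow> ('v \<Rightarrow> 'v) \<Rightarrow> 'v" where
  "image_name \<tau> g = (SOME \<sigma>. bn \<sigma> \<and> (\<forall>x. beq \<tau> (chk x) \<preceq> beq \<sigma> (chk (g x))))"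

definition val :: "'v \<Rightarrow> ('v \<Rightarrow> 'v) \<Rightarrow> 'v set" where
  "val \<tau> g = cls (image_name \<tau> g)"

lemma image_name:
  assumes "bn \<tau>"
  shows "bn (image_name \<tau> g)" "\<And>p x. p \<preceq> beq \<tau> (chk x) \<Longrightarrow> p \<preceq> beq (image_name \<tau> g) (chk (g x))"
proof -
  have "\<exists>\<sigma>. bn \<sigma> \<and> (\<forall>x\<in>UNIV. beq \<tau> (chk x) \<preceq> beq \<sigma> (chk (g x)))"
    by (rule mixing) (use assms forces_eq_check_unique in \<open>auto\<close>)
  then have "\<exists>\<sigma>. bn \<sigma> \<and> (\<forall>x. beq \<tau> (chk x) \<preceq> beq \<sigma> (chk (g x)))" by simp
  then have *: "bn (image_name \<tau> g) \<and> (\<forall>x. beq \<tau> (chk x) \<preceq> beq (image_name \<tau> g) (chk (g x)))"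
    unfolding image_name_def
    by (rule someI_ex[of "\<lambda>\<sigma>. bn \<sigma> \<and> (\<forall>x. beq \<tau> (chk x) \<preceq> beq \<sigma> (chk (g x)))"])
  then show "bn (image_name \<tau> g)" by blast
  fix p x assume "p \<preceq> beq \<tau> (chk x)"
  with * show "p \<preceq> beq (image_name \<tau> g) (chk (g x))" by (blast intro: forces_trans)
qed

lemma ground_image_name:
  assumes "ground_name \<tau>"
  shows "ground_name (image_name \<tau> g)"
proof -
  note [simp] = ground_nameD[OF assms] image_name(1)[OF ground_nameD[OF assms]]
  have "bv_ground L (image_name \<tau> g) \<in> U"
    unfolding bv_ground_eq_value_in
  proof (rule eventually_lawD[OF assms eventually_True])
    fix x p assume "p \<preceq> beq \<tau> (chk x)"
    then have "p \<preceq> beq (image_name \<tau> g) (chk (g x))" by (simp add: image_name(2))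
    then show "p \<preceq> value_in (image_name \<tau> g) (\<lambda>_. True)" by (intro forces_value_inI) auto
  qed simp
  then show ?thesis by (simp add: ground_name_def)
qed

lemma val_in_M: "ground_name \<tau> \<Longrightarrow> val \<tau> g \<in> M"
  unfolding in_boolean_ultrapower_iff val_def
  by (intro exI[of _ "image_name \<tau> g"] conjI ground_image_name HOL.refl)

lemma val_eqI:
  assumes "ground_name \<tau>" "bn \<sigma>"
    and "eventually P (law \<tau>)"
    and "\<And>x p. \<lbrakk>P x; p \<preceq> beq \<tau> (chk x)\<rbrakk> \<Longrightarrow> p \<preceq> beq \<sigma> (chk (g x))"
  shows "val \<tau> g = cls \<sigma>"
proof -
  note [simp] = ground_nameD[OF assms(1)] image_name(1)[OF ground_nameD[OF assms(1)]] assms(2)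
  have "beq (image_name \<tau> g) \<sigma> \<in> U"
  proof (rule eventually_lawD[OF assms(1,3)])
    fix x p assume x: "P x" "p \<preceq> beq \<tau> (chk x)"
    show "p \<preceq> beq (image_name \<tau> g) \<sigma>"
      by (rule forces_eq_trans[of _ "chk (g x)"])
        (use image_name(2)[OF _ x(2)] assms(4)[OF x] in \<open>auto simp: beq_commute\<close>)
  qed simp
  then show ?thesis by (simp add: val_def cls_eq_iff)
qed

lemma val_id: "ground_name \<tau> \<Longrightarrow> val \<tau> (\<lambda>x. x) = cls \<tau>"
  by (rule val_eqI[where P = "\<lambda>_. True"]) (simp_all add: ground_nameD)

lemma val_const: "ground_name \<tau> \<Longrightarrow> val \<tau> (\<lambda>_. c) = uemb L U c"
  unfolding uemb_def
  by (rule val_eqI[where P = "\<lambda>_. True"]) (simp_all add: forces_eq_refl forcesD(1))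

lemma val_eq_iff:
  assumes "ground_name \<tau>"
  shows "val \<tau> g = val \<tau> h \<longleftrightarrow> eventually (\<lambda>x. g x = h x) (law \<tau>)"
proof
  note [simp] = ground_nameD[OF assms] image_name(1)[OF ground_nameD[OF assms]]
  assume "val \<tau> g = val \<tau> h"
  then have "beq (image_name \<tau> g) (image_name \<tau> h) \<in> U" by (simp add: val_def cls_eq_iff)
  then show "eventually (\<lambda>x. g x = h x) (law \<tau>)"
  proof (rule eventually_lawI[OF assms])
    fix x p assume x: "g x \<noteq> h x" "p \<preceq> beq \<tau> (chk x)" and p: "p \<preceq> beq (image_name \<tau> g) (image_name \<tau> h)"
    have "p \<preceq> beq (image_name \<tau> g) (chk (h x))"
      by (rule forces_eq_trans[OF _ _ _ p]) (use image_name(2)[OF _ x(2)] in auto)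
    with image_name(2)[OF _ x(2)] x(1) show "p = \<bottom>"
      by (intro forces_eq_check_unique[of "image_name \<tau> g" p "g x" "h x"]) auto
  qed
next
  assume "eventually (\<lambda>x. g x = h x) (law \<tau>)"
  then show "val \<tau> g = val \<tau> h"
    unfolding val_def[of \<tau> h]
    by (intro val_eqI[OF assms, of _ "\<lambda>x. g x = h x"]) (simp_all add: image_name ground_nameD[OF assms])
qed

lemma umem_val_iff:
  assumes "ground_name \<tau>"
  shows "E (val \<tau> g) (val \<tau> h) \<longleftrightarrow> eventually (\<lambda>x. g x \<in>\<^sub>V h x) (law \<tau>)"
proof -
  note [simp] = ground_nameD[OF assms] image_name(1)[OF ground_nameD[OF assms]]
  have img: "p \<preceq> beq (image_name \<tau> f) (chk (f x))" "p \<preceq> beq (chk (f x)) (image_name \<tau> f)"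
    if "p \<preceq> beq \<tau> (chk x)" for f p x
    using image_name(2)[OF _ that] by (auto simp: beq_commute)
  have "bmem (image_name \<tau> g) (image_name \<tau> h) \<in> U \<longleftrightarrow> eventually (\<lambda>x. g x \<in>\<^sub>V h x) (law \<tau>)"
  proof
    assume "bmem (image_name \<tau> g) (image_name \<tau> h) \<in> U"
    then show "eventually (\<lambda>x. g x \<in>\<^sub>V h x) (law \<tau>)"
    proof (rule eventually_lawI[OF assms])
      fix x p assume x: "\<not> g x \<in>\<^sub>V h x" "p \<preceq> beq \<tau> (chk x)"
        and p: "p \<preceq> bmem (image_name \<tau> g) (image_name \<tau> h)"
      have "p \<preceq> bmem (image_name \<tau> g) (chk (h x))"
        by (rule forces_mem_cong_right[OF _ _ _ _ p]) (use img x in auto)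
      then have "p \<preceq> bmem (chk (g x)) (chk (h x))"
        by (rule forces_mem_cong_left[rotated 4]) (use img x in auto)
      with x(1) show "p = \<bottom>" by (rule forces_check_memD[rotated])
    qed
  next
    assume "eventually (\<lambda>x. g x \<in>\<^sub>V h x) (law \<tau>)"
    then show "bmem (image_name \<tau> g) (image_name \<tau> h) \<in> U"
    proof (rule eventually_lawD[OF assms])
      fix x p assume x: "g x \<in>\<^sub>V h x" "p \<preceq> beq \<tau> (chk x)"
      have "p \<preceq> bmem (chk (g x)) (chk (h x))" by (rule forces_check_mem) (use x in \<open>auto dest: forcesD\<close>)
      then have "p \<preceq> bmem (image_name \<tau> g) (chk (h x))"
        by (rule forces_mem_cong_left[rotated 4]) (use img x in auto)
      then show "p \<preceq> bmem (image_name \<tau> g) (image_name \<tau> h)"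
        by (rule forces_mem_cong_right[rotated 4]) (use img x in auto)
    qed simp
  qed
  then show ?thesis by (simp add: val_def umem_cls_iff)
qed

text \<open>
  In the limit of ultrapowers, \<open>\<pi>\<close> induces the transition map from the ultrapower belonging to
  \<open>\<tau>\<close> to the one belonging to \<open>\<rho>\<close>.
\<close>

definition refines :: "'v \<Rightarrow> ('v \<Rightarrow> 'v) \<Rightarrow> 'v \<Rightarrow> bool" where
  "refines \<rho> \<pi> \<tau> \<longleftrightarrow> ground_name \<rho> \<and> ground_name \<tau> \<and> (\<forall>g. val \<tau> g = val \<rho> (g \<circ> \<pi>))"

lemma top_neq_bottom: "\<top> \<noteq> \<bottom>"
  using top_in_U bottom_notin_U by auto

text \<open>
  The law of \<open>\<tau>\<close> can be read off from equality of values, because \<open>P\<close> holds almost surely iff its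
  indicator function, with the two distinct values \<open>\<top>\<close> and \<open>\<bottom>\<close>, is almost surely \<open>\<top>\<close>.
\<close>

lemma refines_law:
  assumes "refines \<rho> \<pi> \<tau>"
  shows "law \<tau> = filtermap \<pi> (law \<rho>)"
proof (rule filter_eqI)
  fix P :: "'v \<Rightarrow> bool"
  let ?g = "\<lambda>x. if P x then \<top> else \<bottom>"
  have "eventually P (law \<tau>) \<longleftrightarrow> val \<tau> ?g = val \<tau> (\<lambda>_. \<top>)"
    using assms top_neq_bottom by (subst val_eq_iff) (auto simp: refines_def cong: if_cong)
  also have "\<dots> \<longleftrightarrow> val \<rho> (?g \<circ> \<pi>) = val \<rho> ((\<lambda>_. \<top>) \<circ> \<pi>)"
    using assms by (simp add: refines_def)
  also have "\<dots> \<longleftrightarrow> eventually P (filtermap \<pi> (law \<rho>))"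
    using assms top_neq_bottom by (subst val_eq_iff) (auto simp: refines_def eventually_filtermap)
  finally show "eventually P (law \<tau>) \<longleftrightarrow> eventually P (filtermap \<pi> (law \<rho>))" .
qed

lemma refines_self: "ground_name \<tau> \<Longrightarrow> refines \<tau> (\<lambda>x. x) \<tau>"
  by (simp add: refines_def comp_def)

text \<open>
  The values \<open>\<lbrakk>\<tau> = x\<^sup>\<or>\<rbrakk> \<sqinter> \<lbrakk>\<sigma> = y\<^sup>\<or>\<rbrakk>\<close> are pairwise incompatible, so mixing them yields a name for the
  ordered pair of \<open>\<tau>\<close> and \<open>\<sigma>\<close>, from which both are recovered by the projections.
\<close>

lemma common_refinement:
  assumes "ground_name \<tau>" "X \<in> M"
  obtains \<rho> \<pi> h where "refines \<rho> \<pi> \<tau>" "X = val \<rho> h"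
proof -
  obtain \<sigma> where \<sigma>: "ground_name \<sigma>" "X = cls \<sigma>"
    using assms by (auto simp: in_boolean_ultrapower_iff)
  note names [simp] = ground_nameD[OF assms(1)] ground_nameD[OF \<sigma>(1)]
  define a where "a = (\<lambda>(x, y). beq \<tau> (chk x) \<sqinter> beq \<sigma> (chk y))"
  have a_iff: "p \<preceq> a (x, y) \<longleftrightarrow> p \<preceq> beq \<tau> (chk x) \<and> p \<preceq> beq \<sigma> (chk y)" for p x y
    by (simp add: a_def forces_meet_iff)
  have "\<exists>\<rho>. bn \<rho> \<and> (\<forall>i\<in>UNIV. a i \<preceq> beq \<rho> (chk (case i of (x, y) \<Rightarrow> opair x y)))"
  proof (rule mixing)
    show "a i \<in> carrier L" for i by (auto simp: a_def split: prod.split)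
    fix i j p assume ij: "i \<noteq> j" "p \<preceq> a i" "p \<preceq> a j"
    obtain x y x' y' where "i = (x, y)" "j = (x', y')" by (cases i; cases j)
    with ij forces_eq_check_unique[OF names(1), of p x x'] forces_eq_check_unique[OF names(2), of p y y']
    show "p = \<bottom>" by (auto simp: a_iff)
  qed
  then obtain \<rho> where [simp]: "bn \<rho>" and \<rho>: "\<And>x y. a (x, y) \<preceq> beq \<rho> (chk (opair x y))"
    by fastforce
  have pair: "p \<preceq> beq \<rho> (chk (opair x y))" if "p \<preceq> beq \<tau> (chk x)" "p \<preceq> beq \<sigma> (chk y)" for p x y
    using forces_trans[OF _ \<rho>] that by (simp add: a_iff)
  \<comment> \<open>Conditions that decide both \<open>\<tau>\<close> and \<open>\<sigma>\<close> are dense below an element of \<open>U\<close>.\<close>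
  have joint: "r \<in> U"
    if r: "r \<in> carrier L"
      and step: "\<And>p x y. \<lbrakk>p \<preceq> beq \<tau> (chk x); p \<preceq> beq \<sigma> (chk y)\<rbrakk> \<Longrightarrow> p \<preceq> r" for r
  proof (rule U_upward2[OF _ _ r])
    show "value_in \<tau> (\<lambda>_. True) \<in> U" "value_in \<sigma> (\<lambda>_. True) \<in> U"
      using assms(1) \<sigma>(1) by (auto simp: ground_name_def bv_ground_eq_value_in)
    fix p assume p: "p \<preceq> value_in \<tau> (\<lambda>_. True)" "p \<preceq> value_in \<sigma> (\<lambda>_. True)"
    show "p \<preceq> r"
    proof (rule forces_value_inE[OF p(1) names(1) r])
      fix x q assume x: "q \<preceq> p" "q \<preceq> beq \<tau> (chk x)"
      show "q \<preceq> r"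
      proof (rule forces_value_inE[OF forces_trans[OF x(1) p(2)] names(2) r])
        fix y q' assume "q' \<preceq> q" "q' \<preceq> beq \<sigma> (chk y)"
        with x show "q' \<preceq> r" by (blast intro: step forces_trans)
      qed
    qed
  qed
  have ground: "ground_name \<rho>"
    unfolding ground_name_def bv_ground_eq_value_in
    by (auto intro!: joint intro: forces_value_inI[of _ _ "opair _ _"] pair)
  define \<pi>1 \<pi>2 where "\<pi>1 z = (THE x. \<exists>y. z = opair x y)" and "\<pi>2 z = (THE y. \<exists>x. z = opair x y)"
    for z :: 'v
  have \<pi> [simp]: "\<pi>1 (opair x y) = x" "\<pi>2 (opair x y) = y" for x y
    by (auto simp: \<pi>1_def \<pi>2_def)
  have "val \<tau> g = val \<rho> (g \<circ> \<pi>1)" for g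
  proof -
    note [simp] = image_name(1)[OF names(1)] image_name(1)[OF \<open>bn \<rho>\<close>]
    have "beq (image_name \<tau> g) (image_name \<rho> (g \<circ> \<pi>1)) \<in> U"
    proof (rule joint)
      fix p x y assume p: "p \<preceq> beq \<tau> (chk x)" "p \<preceq> beq \<sigma> (chk y)"
      show "p \<preceq> beq (image_name \<tau> g) (image_name \<rho> (g \<circ> \<pi>1))"
        by (rule forces_eq_trans[of _ "chk (g x)"])
          (use image_name(2)[OF names(1) p(1), of g] image_name(2)[OF \<open>bn \<rho>\<close> pair[OF p], of "g \<circ> \<pi>1"]
            in \<open>auto simp: beq_commute\<close>)
    qed simp
    then show ?thesis by (simp add: val_def cls_eq_iff)
  qed
  moreover have "cls \<sigma> = val \<rho> \<pi>2"
  proof -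
    note [simp] = image_name(1)[OF \<open>bn \<rho>\<close>]
    have "beq \<sigma> (image_name \<rho> \<pi>2) \<in> U"
    proof (rule joint)
      fix p x y assume p: "p \<preceq> beq \<tau> (chk x)" "p \<preceq> beq \<sigma> (chk y)"
      show "p \<preceq> beq \<sigma> (image_name \<rho> \<pi>2)"
        by (rule forces_eq_trans[of _ "chk y"])
          (use p image_name(2)[OF \<open>bn \<rho>\<close> pair[OF p], of \<pi>2] in \<open>auto simp: beq_commute\<close>)
    qed simp
    then show ?thesis by (simp add: val_def cls_eq_iff)
  qed
  ultimately show ?thesis
    using assms(1) ground \<sigma> by (intro that[of \<rho> \<pi>1 \<pi>2]) (auto simp: refines_def)
qed

section \<open>The theorem of Los for functions and their values\<close>

lemma refinesD: "refines \<rho> \<pi> \<tau> \<Longrightarrow> ground_name \<rho>" "refines \<rho> \<pi> \<tau> \<Longrightarrow> val \<tau> g = val \<rho> (g \<circ> \<pi>)"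
  by (auto simp: refines_def)

lemma eventually_law_imp_iff:
  assumes "ground_name \<tau>"
  shows "eventually (\<lambda>x. P x \<longrightarrow> Q x) (law \<tau>) \<longleftrightarrow> (eventually P (law \<tau>) \<longrightarrow> eventually Q (law \<tau>))"
proof -
  have "eventually (\<lambda>x. P x \<longrightarrow> Q x) (law \<tau>) \<longleftrightarrow> \<not> eventually (\<lambda>x. P x \<and> \<not> Q x) (law \<tau>)"
    by (simp flip: eventually_law_not_iff[OF assms])
  also have "\<dots> \<longleftrightarrow> (eventually P (law \<tau>) \<longrightarrow> eventually Q (law \<tau>))"
    by (simp add: eventually_conj_iff eventually_law_not_iff[OF assms])
  finally show ?thesis .
qed

lemma eventually_law_iff_iff:
  assumes "ground_name \<tau>"
  shows "eventually (\<lambda>x. P x \<longleftrightarrow> Q x) (law \<tau>) \<longleftrightarrow> (eventually P (law \<tau>) \<longleftrightarrow> eventually Q (law \<tau>))"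
  unfolding iff_conv_conj_imp by (simp add: eventually_conj_iff eventually_law_imp_iff assms)

lemma eventually_law_disj_iff:
  assumes "ground_name \<tau>"
  shows "eventually (\<lambda>x. P x \<or> Q x) (law \<tau>) \<longleftrightarrow> eventually P (law \<tau>) \<or> eventually Q (law \<tau>)"
  by (simp only: disj_imp eventually_law_imp_iff[OF assms] eventually_law_not_iff[OF assms])

lemmas eventually_law_connectives =
  eventually_conj_iff eventually_law_imp_iff eventually_law_iff_iff eventually_law_disj_iff

text \<open>
  One quantifier step.  A witness in the ultrapower is a value of a name that may refine \<open>\<tau>\<close>, so the
  equivalence for \<open>R\<close> is assumed for all refinements.  Conversely, witnesses are chosen for each value
  of \<open>\<tau>\<close> separately.
\<close>

lemma Los_ex:
  assumes "ground_name \<tau>"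
    and step: "\<And>\<rho> \<pi> h. refines \<rho> \<pi> \<tau> \<Longrightarrow> R (val \<rho> h) \<longleftrightarrow> eventually (\<lambda>z. P (\<pi> z) (h z)) (law \<rho>)"
  shows "(\<exists>X\<in>M. R X) \<longleftrightarrow> eventually (\<lambda>x. \<exists>y. P x y) (law \<tau>)"
proof
  assume "\<exists>X\<in>M. R X"
  then obtain X where X: "X \<in> M" "R X" by blast
  obtain \<rho> \<pi> h where \<rho>: "refines \<rho> \<pi> \<tau>" "X = val \<rho> h"
    using common_refinement[OF assms(1) X(1)] .
  with X step have "eventually (\<lambda>z. P (\<pi> z) (h z)) (law \<rho>)" by simp
  then have "eventually (\<lambda>z. \<exists>y. P (\<pi> z) y) (law \<rho>)" by eventually_elim blast
  with \<rho>(1) show "eventually (\<lambda>x. \<exists>y. P x y) (law \<tau>)"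
    by (simp add: refines_law eventually_filtermap)
next
  assume "eventually (\<lambda>x. \<exists>y. P x y) (law \<tau>)"
  then have "eventually (\<lambda>x. P x (SOME y. P x y)) (law \<tau>)"
    by eventually_elim (rule someI_ex)
  then have "R (val \<tau> (\<lambda>x. SOME y. P x y))"
    using step[OF refines_self[OF assms(1)]] by simp
  then show "\<exists>X\<in>M. R X" using val_in_M[OF assms(1)] by blast
qed

lemma Los_all:
  assumes "ground_name \<tau>"
    and step: "\<And>\<rho> \<pi> h. refines \<rho> \<pi> \<tau> \<Longrightarrow> R (val \<rho> h) \<longleftrightarrow> eventually (\<lambda>z. P (\<pi> z) (h z)) (law \<rho>)"
  shows "(\<forall>X\<in>M. R X) \<longleftrightarrow> eventually (\<lambda>x. \<forall>y. P x y) (law \<tau>)"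
proof -
  have "(\<exists>X\<in>M. \<not> R X) \<longleftrightarrow> eventually (\<lambda>x. \<exists>y. \<not> P x y) (law \<tau>)"
    using assms(1) by (rule Los_ex) (simp add: step eventually_law_not_iff refinesD(1))
  also have "\<dots> \<longleftrightarrow> \<not> eventually (\<lambda>x. \<forall>y. P x y) (law \<tau>)"
    by (simp flip: eventually_law_not_iff[OF assms(1)])
  finally show ?thesis by blast
qed

lemma Los_upair:
  assumes "ground_name \<tau>"
  shows "sat_upair M E (val \<tau> a) (val \<tau> b) (val \<tau> p) \<longleftrightarrow>
    eventually (\<lambda>x. sat_upair UNIV (\<in>\<^sub>V) (a x) (b x) (p x)) (law \<tau>)"
  unfolding sat_upair_def ball_UNIV
  by (rule Los_all[OF assms])
    (simp add: refinesD umem_val_iff val_eq_iff eventually_law_connectives)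

lemma Los_opair:
  assumes "ground_name \<tau>"
  shows "sat_opair M E (val \<tau> a) (val \<tau> b) (val \<tau> p) \<longleftrightarrow>
    eventually (\<lambda>x. sat_opair UNIV (\<in>\<^sub>V) (a x) (b x) (p x)) (law \<tau>)"
  unfolding sat_opair_def bex_UNIV
proof (rule Los_ex[OF assms])
  fix \<rho> \<pi> u assume \<rho>: "refines \<rho> \<pi> \<tau>"
  show "(\<exists>v\<in>M. sat_upair M E (val \<tau> a) (val \<tau> a) (val \<rho> u) \<and> sat_upair M E (val \<tau> a) (val \<tau> b) v \<and>
          sat_upair M E (val \<rho> u) v (val \<tau> p)) \<longleftrightarrow>
      eventually (\<lambda>z. \<exists>v. sat_upair UNIV (\<in>\<^sub>V) (a (\<pi> z)) (a (\<pi> z)) (u z) \<and>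
        sat_upair UNIV (\<in>\<^sub>V) (a (\<pi> z)) (b (\<pi> z)) v \<and> sat_upair UNIV (\<in>\<^sub>V) (u z) v (p (\<pi> z))) (law \<rho>)"
    unfolding refinesD(2)[OF \<rho>]
    by (rule Los_ex[OF refinesD(1)[OF \<rho>]])
      (simp add: refinesD Los_upair eventually_law_connectives)
qed

lemma Los_maps:
  assumes "ground_name \<tau>"
  shows "sat_maps M E (val \<tau> f) (val \<tau> a) (val \<tau> y) \<longleftrightarrow>
    eventually (\<lambda>x. sat_maps UNIV (\<in>\<^sub>V) (f x) (a x) (y x)) (law \<tau>)"
  unfolding sat_maps_def bex_UNIV
  by (rule Los_ex[OF assms])
    (simp add: refinesD Los_opair umem_val_iff eventually_law_connectives)

lemma Los_function:
  assumes "ground_name \<tau>"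
  shows "sat_function M E (val \<tau> f) (val \<tau> D) \<longleftrightarrow>
    eventually (\<lambda>x. sat_function UNIV (\<in>\<^sub>V) (f x) (D x)) (law \<tau>)"
proof -
  \<comment> \<open>Unique existence as a plain quantifier prefix, so that the quantifier steps apply to it.\<close>
  have unique: "(\<exists>!y. y \<in> N \<and> Q y) \<longleftrightarrow> (\<exists>y\<in>N. \<forall>z\<in>N. Q z \<longleftrightarrow> z = y)" for N and Q :: "'m \<Rightarrow> bool"
    by (auto simp: Ex1_def; blast)
  have "(\<forall>p\<in>M. E p (val \<tau> f) \<longrightarrow> (\<exists>a\<in>M. \<exists>y\<in>M. E a (val \<tau> D) \<and> sat_opair M E a y p)) \<longleftrightarrow>
      eventually (\<lambda>x. \<forall>p. p \<in>\<^sub>V f x \<longrightarrow>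
        (\<exists>a y. a \<in>\<^sub>V D x \<and> sat_opair UNIV (\<in>\<^sub>V) a y p)) (law \<tau>)"
  proof (rule Los_all[OF assms])
    fix \<rho> \<pi> p assume \<rho>: "refines \<rho> \<pi> \<tau>"
    have "(\<exists>a\<in>M. \<exists>y\<in>M. E a (val \<tau> D) \<and> sat_opair M E a y (val \<rho> p)) \<longleftrightarrow>
      eventually (\<lambda>z. \<exists>a y. a \<in>\<^sub>V D (\<pi> z) \<and> sat_opair UNIV (\<in>\<^sub>V) a y (p z)) (law \<rho>)"
      unfolding refinesD(2)[OF \<rho>]
    proof (rule Los_ex[OF refinesD(1)[OF \<rho>]])
      fix \<rho>' \<pi>' a assume \<rho>': "refines \<rho>' \<pi>' \<rho>"
      show "(\<exists>y\<in>M. E (val \<rho>' a) (val \<rho> (D \<circ> \<pi>)) \<and> sat_opair M E (val \<rho>' a) y (val \<rho> p)) \<longleftrightarrow>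
        eventually (\<lambda>z. \<exists>y. a z \<in>\<^sub>V D (\<pi> (\<pi>' z)) \<and> sat_opair UNIV (\<in>\<^sub>V) (a z) y (p (\<pi>' z))) (law \<rho>')"
        unfolding refinesD(2)[OF \<rho>']
        by (rule Los_ex[OF refinesD(1)[OF \<rho>']])
          (simp add: refinesD Los_opair umem_val_iff eventually_law_connectives)
    qed
    then show "(E (val \<rho> p) (val \<tau> f) \<longrightarrow> (\<exists>a\<in>M. \<exists>y\<in>M. E a (val \<tau> D) \<and> sat_opair M E a y (val \<rho> p))) \<longleftrightarrow>
      eventually (\<lambda>z. p z \<in>\<^sub>V f (\<pi> z) \<longrightarrow>
        (\<exists>a y. a \<in>\<^sub>V D (\<pi> z) \<and> sat_opair UNIV (\<in>\<^sub>V) a y (p z))) (law \<rho>)"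
      by (simp add: refinesD[OF \<rho>] umem_val_iff eventually_law_connectives)
  qed
  moreover have "(\<forall>a\<in>M. E a (val \<tau> D) \<longrightarrow> (\<exists>!y. y \<in> M \<and> sat_maps M E (val \<tau> f) a y)) \<longleftrightarrow>
      eventually (\<lambda>x. \<forall>a. a \<in>\<^sub>V D x \<longrightarrow> (\<exists>!y. y \<in> UNIV \<and> sat_maps UNIV (\<in>\<^sub>V) (f x) a y)) (law \<tau>)"
    unfolding unique bex_UNIV ball_UNIV
  proof (rule Los_all[OF assms])
    fix \<rho> \<pi> a assume \<rho>: "refines \<rho> \<pi> \<tau>"
    have "(\<exists>y\<in>M. \<forall>y'\<in>M. sat_maps M E (val \<tau> f) (val \<rho> a) y' \<longleftrightarrow> y' = y) \<longleftrightarrow>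
      eventually (\<lambda>z. \<exists>y. \<forall>y'. sat_maps UNIV (\<in>\<^sub>V) (f (\<pi> z)) (a z) y' \<longleftrightarrow> y' = y) (law \<rho>)"
      unfolding refinesD(2)[OF \<rho>]
    proof (rule Los_ex[OF refinesD(1)[OF \<rho>]])
      fix \<rho>' \<pi>' y assume \<rho>': "refines \<rho>' \<pi>' \<rho>"
      show "(\<forall>y'\<in>M. sat_maps M E (val \<rho> (f \<circ> \<pi>)) (val \<rho> a) y' \<longleftrightarrow> y' = val \<rho>' y) \<longleftrightarrow>
        eventually (\<lambda>z. \<forall>y'. sat_maps UNIV (\<in>\<^sub>V) (f (\<pi> (\<pi>' z))) (a (\<pi>' z)) y' \<longleftrightarrow> y' = y z) (law \<rho>')"
        unfolding refinesD(2)[OF \<rho>']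
        by (rule Los_all[OF refinesD(1)[OF \<rho>']])
          (simp add: refinesD Los_maps val_eq_iff eventually_law_connectives)
    qed
    then show "(E (val \<rho> a) (val \<tau> D) \<longrightarrow> (\<exists>y\<in>M. \<forall>y'\<in>M. sat_maps M E (val \<tau> f) (val \<rho> a) y' \<longleftrightarrow> y' = y)) \<longleftrightarrow>
      eventually (\<lambda>z. a z \<in>\<^sub>V D (\<pi> z) \<longrightarrow>
        (\<exists>y. \<forall>y'. sat_maps UNIV (\<in>\<^sub>V) (f (\<pi> z)) (a z) y' \<longleftrightarrow> y' = y)) (law \<rho>)"
      by (simp add: refinesD[OF \<rho>] umem_val_iff eventually_law_connectives)
  qed
  ultimately show ?thesis
    unfolding sat_function_def by (simp add: eventually_conj_iff)
qed

lemma ground_name_check: "ground_name (chk x)"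
proof -
  have "\<top> \<preceq> value_in (chk x) (\<lambda>_. True)"
    by (rule forces_value_inI[of _ _ x]) (simp_all add: forces_eq_refl)
  then show ?thesis
    unfolding ground_name_def bv_ground_eq_value_in using U_upward[OF top_in_U] by simp
qed

lemma ufunction_uemb:
  assumes "vfunction f D"
  shows "ufunction L U (uemb L U f) (uemb L U D)"
proof -
  obtain \<tau> where \<tau>: "ground_name \<tau>" using ground_name_check by blast
  then have "sat_function M E (val \<tau> (\<lambda>_. f)) (val \<tau> (\<lambda>_. D))"
    by (subst Los_function) (use assms in auto)
  then show ?thesis by (simp add: val_const \<tau>)
qed

lemma uapply_in_M:
  assumes "vfunction f D" "b \<in> M" "E b (uemb L U D)"
  shows "uapply L U (uemb L U f) b \<in> M"
proof -
  have "\<exists>!y. y \<in> M \<and> sat_maps M E (uemb L U f) b y"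
    using ufunction_uemb[OF assms(1)] assms(2,3) by (auto simp: sat_function_def)
  from theI'[OF this] show ?thesis by (simp add: sat_apply_def)
qed

lemma uapply_val_eq:
  assumes "ground_name \<tau>" "vfunction f D" "eventually (\<lambda>x. opair (a x) (y x) \<in>\<^sub>V f) (law \<tau>)"
    and "E (val \<tau> a) (uemb L U D)"
  shows "uapply L U (uemb L U f) (val \<tau> a) = val \<tau> y"
proof -
  have "sat_maps M E (val \<tau> (\<lambda>_. f)) (val \<tau> a) (val \<tau> y)"
    by (subst Los_maps) (use assms in \<open>simp_all add: sat_maps_universe\<close>)
  then have "val \<tau> y \<in> M \<and> sat_maps M E (uemb L U f) (val \<tau> a) (val \<tau> y)"
    by (simp add: val_in_M val_const assms(1))
  moreover have "\<exists>!y. y \<in> M \<and> sat_maps M E (uemb L U f) (val \<tau> a) y"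
    using ufunction_uemb[OF assms(2)] assms(4) val_in_M[OF assms(1)] by (auto simp: sat_function_def)
  ultimately show ?thesis unfolding sat_apply_def by (intro the1_equality)
qed

section \<open>The generic element of a maximal antichain\<close>

lemma maximal_antichain_cover_in_U:
  assumes "maximal_antichain L A" "r \<in> carrier L" "\<And>a. a \<in> A \<Longrightarrow> a \<preceq> r"
  shows "r \<in> U"
proof (rule U_upward[OF top_in_U])
  have A: "A \<subseteq> carrier L" using assms(1) by (auto simp: maximal_antichain_def antichain_def)
  show "\<top> \<preceq> r"
  proof (rule forces_SupE[of _ A])
    show "\<top> \<preceq> \<Squnion> A"
      by (simp add: Sup_eq_top_of_maximal_antichain[OF assms(1)] forces_refl)
    fix s q assume "s \<in> A" "q \<preceq> s"
    then show "q \<preceq> r" using assms(3) forces_trans by blast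
  qed (use A assms in auto)
qed

lemma antichain_disjoint:
  assumes "antichain L A" "a \<in> A" "b \<in> A" "a \<noteq> b" "p \<preceq> a" "p \<preceq> b"
  shows "p = \<bottom>"
proof -
  have "p \<preceq> a \<sqinter> b" using assms(5,6) by (simp add: forces_meet_iff forcesD(2))
  moreover have "a \<sqinter> b = \<bottom>" using assms(1-4) by (simp add: antichain_def)
  ultimately show ?thesis by (simp add: forces_bottom_iff)
qed

lemma in_generic_filter_iff:
  "bn \<sigma> \<Longrightarrow> cls \<sigma> \<in> generic_filter L U \<longleftrightarrow> cls \<sigma> \<in> M \<and> bmem \<sigma> (generic_name L) \<in> U"
  by (simp add: generic_filter_def umem_cls_iff)

lemma forces_generic_memI:
  "\<lbrakk>bn \<sigma>; p \<preceq> beq \<sigma> (chk b); p \<preceq> b\<rbrakk> \<Longrightarrow> p \<preceq> bmem \<sigma> (generic_name L)"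
  by (rule forces_memI[of _ _ "chk b" b]) (auto simp: opair_in_generic_name_iff dest: forcesD)

text \<open>
  The name that mixes the elements of \<open>A\<close>, each with value itself, is forced into \<open>A\<^sup>\<or>\<close> and into
  the generic filter.  Conversely, a condition that forces \<open>\<sigma>\<close> to be \<open>a\<^sup>\<or>\<close> with \<open>a \<in> A\<close> and forces
  \<open>\<sigma>\<close> into the generic filter can be strengthened to lie below \<open>a\<close>, where the mixed name is
  \<open>a\<^sup>\<or>\<close> too.
\<close>

lemma generic_elt_unique:
  assumes max: "maximal_antichain L (elts A)"
  shows "\<exists>!b. b \<in> generic_filter L U \<and> E b (uemb L U A)"
proof -
  have anti: "antichain L (elts A)" using max by (simp add: maximal_antichain_def)
  then have A: "elts A \<subseteq> carrier L" by (auto simp: antichain_def)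
  have "\<exists>\<beta>. bn \<beta> \<and> (\<forall>a\<in>elts A. a \<preceq> beq \<beta> (chk a))"
    by (rule mixing[where a = "\<lambda>x. x"]) (use A antichain_disjoint[OF anti] in auto)
  then obtain \<beta> where [simp]: "bn \<beta>" and \<beta>: "\<And>a. a \<in> elts A \<Longrightarrow> a \<preceq> beq \<beta> (chk a)" by blast
  have "cls \<beta> \<in> M"
    unfolding in_boolean_ultrapower_iff ground_name_def bv_ground_eq_value_in
    by (intro exI[of _ \<beta>] conjI HOL.refl maximal_antichain_cover_in_U[OF max])
      (auto intro: forces_value_inI \<beta>)
  moreover have "bmem \<beta> (generic_name L) \<in> U"
  proof (rule maximal_antichain_cover_in_U[OF max])
    fix a assume a: "a \<in> elts A"
    with A have "a \<preceq> a" by (auto intro: forces_refl)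
    with \<beta>[OF a] show "a \<preceq> bmem \<beta> (generic_name L)" by (intro forces_generic_memI[of _ _ a]) auto
  qed simp
  moreover have "bmem \<beta> (chk A) \<in> U"
  proof (rule maximal_antichain_cover_in_U[OF max])
    fix a assume a: "a \<in> elts A"
    then have "opair (chk a) \<top> \<in>\<^sub>V chk A" by (auto simp: opair_in_check_iff elts_def)
    moreover have "a \<preceq> \<top>" using a A by (auto intro: forces_top)
    ultimately show "a \<preceq> bmem \<beta> (chk A)" using \<beta>[OF a] by (intro forces_memI) auto
  qed simp
  ultimately have ex: "cls \<beta> \<in> generic_filter L U \<and> E (cls \<beta>) (uemb L U A)"
    by (simp add: in_generic_filter_iff uemb_def umem_cls_iff)
  moreover have "Y = cls \<beta>" if Y: "Y \<in> generic_filter L U \<and> E Y (uemb L U A)" for Y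
  proof -
    from Y obtain \<sigma> where \<sigma>: "ground_name \<sigma>" "Y = cls \<sigma>"
      by (auto simp: generic_filter_def in_boolean_ultrapower_iff)
    note [simp] = ground_nameD[OF \<sigma>(1)]
    have "bmem \<sigma> (generic_name L) \<in> U" "bmem \<sigma> (chk A) \<in> U"
      using Y \<sigma> by (simp_all add: in_generic_filter_iff uemb_def umem_cls_iff)
    then have "beq \<sigma> \<beta> \<in> U"
    proof (rule U_upward2)
      fix p assume p: "p \<preceq> bmem \<sigma> (generic_name L)" "p \<preceq> bmem \<sigma> (chk A)"
      show "p \<preceq> beq \<sigma> \<beta>"
      proof (rule forces_memE[OF p(1)])
        fix \<eta> b q
        assume "opair \<eta> b \<in>\<^sub>V generic_name L" "q \<preceq> p" "q \<preceq> beq \<sigma> \<eta>" "q \<preceq> b"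
        then have q: "q \<preceq> p" "q \<preceq> beq \<sigma> (chk b)" "q \<preceq> b"
          by (auto simp: opair_in_generic_name_iff)
        show "q \<preceq> beq \<sigma> \<beta>"
        proof (rule forces_memE[OF forces_trans[OF q(1) p(2)]])
          fix \<zeta> c q' assume "opair \<zeta> c \<in>\<^sub>V chk A" "q' \<preceq> q" "q' \<preceq> beq \<sigma> \<zeta>"
          then obtain a where a: "a \<in> elts A" "q' \<preceq> q" "q' \<preceq> beq \<sigma> (chk a)"
            by (auto simp: opair_in_check_iff elts_def)
          show "q' \<preceq> beq \<sigma> \<beta>"
          proof (cases "a = b")
            case True
            have "q' \<preceq> beq (chk a) \<beta>"
              using forces_trans[OF forces_trans[OF a(2) q(3)]] \<beta>[OF a(1)] True
              by (simp add: beq_commute)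
            then show ?thesis by (intro forces_eq_trans[OF _ _ _ a(3)]) auto
          next
            case False
            then have "q' = \<bottom>"
              using forces_eq_check_unique[OF _ a(3) forces_trans[OF a(2) q(2)]] by simp
            then show ?thesis by (simp add: bottom_forces)
          qed
        qed auto
      qed auto
    qed simp
    then show ?thesis by (simp add: \<sigma>(2) cls_eq_iff)
  qed
  ultimately show ?thesis by blast
qed

lemma generic_elt:
  assumes "maximal_antichain L (elts A)"
  shows "generic_elt L U A \<in> generic_filter L U" "E (generic_elt L U A) (uemb L U A)"
  using theI'[OF generic_elt_unique[OF assms]] by (simp_all add: generic_elt_def)

lemma generic_elt_equality:
  assumes "maximal_antichain L (elts A)" "b \<in> generic_filter L U" "E b (uemb L U A)"
  shows "generic_elt L U A = b"
  unfolding generic_elt_def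
  by (rule the1_equality[OF generic_elt_unique[OF assms(1)]]) (use assms(2,3) in blast)

section \<open>Elements of the ultrapower as values at generic elements\<close>

lemma uemb_mono:
  assumes "b \<in> M" "E b (uemb L U A)" "elts A \<subseteq> elts D"
  shows "E b (uemb L U D)"
proof -
  obtain \<tau> where \<tau>: "ground_name \<tau>" "b = cls \<tau>"
    using assms by (auto simp: in_boolean_ultrapower_iff)
  then have "eventually (\<lambda>x. x \<in>\<^sub>V A) (law \<tau>)"
    using assms(2) by (simp flip: val_const[OF \<tau>(1)] val_id umem_val_iff)
  then have "eventually (\<lambda>x. x \<in>\<^sub>V D) (law \<tau>)"
    by eventually_elim (use assms(3) in \<open>auto simp: vmem_iff_elts\<close>)
  then show ?thesis
    using \<tau> by (simp add: umem_val_iff flip: val_const[OF \<tau>(1)] val_id)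
qed

text \<open>
  The function is given as the graph of a class function over any domain \<open>D\<close> that includes \<open>A\<close>, so
  that the same argument serves functions defined on \<open>A\<close> and functions defined on the whole
  algebra.
\<close>

lemma ultrapower_element_representation:
  assumes "X \<in> M"
  obtains A g where "maximal_antichain L (elts A)"
    and "\<And>D. elts A \<subseteq> elts D \<Longrightarrow>
      X = uapply L U (uemb L U (graph g D)) (generic_elt L U A)"
proof -
  obtain \<tau> where \<tau>: "ground_name \<tau>" "X = cls \<tau>"
    using assms by (auto simp: in_boolean_ultrapower_iff)
  note name [simp] = ground_nameD[OF \<tau>(1)] image_name(1)[OF ground_nameD[OF \<tau>(1)]]
  define v where "v x = beq \<tau> (chk x)" for x
  \<comment> \<open>The remainder \<open>c\<close> makes the antichain maximal; the generic element avoids it because the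
      supremum of the other elements is in \<open>U\<close>.\<close>
  define c where "c = bcompl L (bv_ground L \<tau>)"
  define S where "S = insert c (range v) - {\<bottom>}"
  have v [simp]: "v x \<in> carrier L" for x by (simp add: v_def)
  have ground [simp]: "bv_ground L \<tau> \<in> carrier L" by (simp add: bv_ground_eq_value_in)
  have c: "c \<in> carrier L" "bv_ground L \<tau> \<sqinter> c = \<bottom>" "bv_ground L \<tau> \<squnion> c = \<top>"
    by (simp_all add: c_def bcompl)
  have v_le: "v x \<preceq> bv_ground L \<tau>" for x
    unfolding bv_ground_eq_value_in by (rule forces_value_inI[of _ _ x]) (simp_all add: v_def forces_refl)
  have disjoint: "p = \<bottom>" if "p \<preceq> v x" "p \<preceq> v y" "x \<noteq> y" for p x y
    by (rule forces_eq_check_unique[OF name(1)]) (use that in \<open>simp_all add: v_def\<close>)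
  have disjoint_c: "p = \<bottom>" if "p \<preceq> v x" "p \<preceq> c" for p x
  proof -
    have "p \<preceq> bv_ground L \<tau> \<sqinter> c"
      using that v_le[of x] c(1) forces_trans by (subst forces_meet_iff) auto
    then show ?thesis by (simp add: c forces_bottom_iff)
  qed
  have S: "S \<subseteq> carrier L" using c by (auto simp: S_def)
  have "small S" using small_carrier S by (rule small_subset)
  then have elts_S: "elts (vset S) = S" by (rule elts_vset_small)
  have "antichain L S"
    unfolding antichain_def
  proof (intro conjI ballI impI)
    show "S \<subseteq> carrier L - {\<bottom>}" using S by (auto simp: S_def)
    fix a b assume ab: "a \<in> S" "b \<in> S" "a \<noteq> b"
    then have "a \<in> carrier L" "b \<in> carrier L" using S by auto
    then have meet: "a \<sqinter> b \<preceq> a" "a \<sqinter> b \<preceq> b"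
      by (simp_all add: forces_def meet_left meet_right)
    from ab consider x y where "a = v x" "b = v y" "x \<noteq> y" | x where "a = v x" "b = c"
      | x where "a = c" "b = v x"
      by (auto simp: S_def)
    then show "a \<sqinter> b = \<bottom>"
      by cases (use meet disjoint disjoint_c in blast)+
  qed
  moreover have "\<Squnion> S = \<top>"
  proof -
    have le: "s \<preceq> \<Squnion> S" if "s \<in> insert c (range v)" for s
    proof (cases "s = \<bottom>")
      case True
      then show ?thesis using S by (simp add: bottom_forces)
    next
      case False
      with that S have "s \<in> S" by (simp add: S_def)
      with S show ?thesis by (intro forces_SupI[of s]) (auto intro: forces_refl)
    qed
    have "bv_ground L \<tau> \<preceq> \<Squnion> S"
    proof (rule forces_value_inE)
      show "bv_ground L \<tau> \<preceq> value_in \<tau> (\<lambda>_. True)"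
        using forces_refl[OF ground] by (simp only: bv_ground_eq_value_in)
      show "q \<preceq> \<Squnion> S" if "q \<preceq> beq \<tau> (chk x)" for q x
        using that le[of "v x"] forces_trans by (auto simp: v_def)
    qed (use S in auto)
    moreover have "c \<preceq> \<Squnion> S" using le by simp
    ultimately have "bv_ground L \<tau> \<squnion> c \<sqsubseteq> \<Squnion> S"
      by (intro join_le) (auto simp: forces_def)
    then show ?thesis using S c by (simp add: top_le_iff)
  qed
  ultimately have max: "maximal_antichain L (elts (vset S))"
    by (simp add: elts_S maximal_antichainI)
  have v_nonzero: "eventually (\<lambda>x. v x \<noteq> \<bottom>) (law \<tau>)"
    by (rule eventually_lawI[OF \<tau>(1) top_in_U]) (auto simp: forces_bottom_iff v_def)
  then have v_in_S: "eventually (\<lambda>x. v x \<in>\<^sub>V vset S) (law \<tau>)"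
    by eventually_elim (simp add: vmem_iff_elts elts_S, simp add: S_def)
  have "val \<tau> v \<in> generic_filter L U"
    unfolding val_def in_generic_filter_iff[OF name(2)]
  proof
    show "cls (image_name \<tau> v) \<in> M" using val_in_M[OF \<tau>(1), of v] by (simp only: val_def)
    show "bmem (image_name \<tau> v) (generic_name L) \<in> U"
    proof (rule eventually_lawD[OF \<tau>(1) eventually_True])
      fix x p assume p: "p \<preceq> beq \<tau> (chk x)"
      then show "p \<preceq> bmem (image_name \<tau> v) (generic_name L)"
        by (intro forces_generic_memI[of _ _ "v x"] image_name) (simp_all add: v_def)
    qed simp
  qed
  moreover have v_in_j_S: "E (val \<tau> v) (uemb L U (vset S))"
    using v_in_S by (simp add: umem_val_iff \<tau>(1) flip: val_const[OF \<tau>(1)])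
  ultimately have b: "generic_elt L U (vset S) = val \<tau> v"
    by (rule generic_elt_equality[OF max])
  \<comment> \<open>Decoding: a nonzero value \<open>v x\<close> determines \<open>x\<close>.\<close>
  define g where "g b = (SOME x. v x = b)" for b
  have g: "g (v x) = x" if "v x \<noteq> \<bottom>" for x
  proof -
    have "v (g (v x)) = v x" unfolding g_def by (rule someI) (rule HOL.refl)
    then show ?thesis using disjoint[of "v x" "g (v x)" x] forces_refl[OF v[of x]] that by auto
  qed
  have "X = uapply L U (uemb L U (graph g D)) (generic_elt L U (vset S))"
    if D: "elts (vset S) \<subseteq> elts D" for D
  proof -
    have "eventually (\<lambda>x. opair (v x) x \<in>\<^sub>V graph g D) (law \<tau>)"
      using v_nonzero v_in_S
      by eventually_elim (use D g in \<open>auto simp: opair_in_graph_iff elts_def\<close>)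
    from uapply_val_eq[OF \<tau>(1) vfunction_graph this] uemb_mono[OF val_in_M[OF \<tau>(1)] v_in_j_S D]
    have "uapply L U (uemb L U (graph g D)) (val \<tau> v) = val \<tau> (\<lambda>x. x)" .
    then show ?thesis by (simp add: b \<tau> val_id)
  qed
  with max show ?thesis by (rule that)
qed

end

theorem theorem37:
  fixes \<BB> :: "'v::zfc_universe gorder" and B :: 'v and U :: "'v set"
  assumes "complete_boolean_lattice \<BB>" and "elts B = carrier \<BB>"
    and "ultrafilter_on \<BB> U"
  shows
    "(\<forall>f D. vfunction f D \<longrightarrow> ufunction \<BB> U (uemb \<BB> U f) (uemb \<BB> U D)) \<and>
     boolean_ultrapower \<BB> U =
       {uapply \<BB> U (uemb \<BB> U f) b | f b.
          vfunction f B \<and> b \<in> boolean_ultrapower \<BB> U \<and> umem \<BB> U b (uemb \<BB> U B)} \<and>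
     (\<forall>A. maximal_antichain \<BB> (elts A) \<longrightarrow>
        (\<exists>!b. b \<in> generic_filter \<BB> U \<and> umem \<BB> U b (uemb \<BB> U A))) \<and>
     boolean_ultrapower \<BB> U =
       {uapply \<BB> U (uemb \<BB> U f) (generic_elt \<BB> U A) | f A.
          maximal_antichain \<BB> (elts A) \<and> vfunction f A}"
proof -
  interpret complete_lattice \<BB>
    using assms(1) by (simp add: complete_boolean_lattice_def)
  interpret boolean_ultrapower_universe \<BB> U
    by unfold_locales (use assms in \<open>auto simp: small_def\<close>)
  have generic_in_M: "generic_elt \<BB> U A \<in> M" if "maximal_antichain \<BB> (elts A)" for A
    using generic_elt(1)[OF that] by (simp add: generic_filter_def)
  have "X \<in> {uapply \<BB> U (uemb \<BB> U f) b | f b. vfunction f B \<and> b \<in> M \<and> E b (uemb \<BB> U B)} \<and>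
      X \<in> {uapply \<BB> U (uemb \<BB> U f) (generic_elt \<BB> U A) | f A.
        maximal_antichain \<BB> (elts A) \<and> vfunction f A}" if X_in_M: "X \<in> M" for X
  proof -
    obtain A g where A: "maximal_antichain \<BB> (elts A)"
      and X: "\<And>D. elts A \<subseteq> elts D \<Longrightarrow>
        X = uapply \<BB> U (uemb \<BB> U (graph g D)) (generic_elt \<BB> U A)"
      using ultrapower_element_representation[OF X_in_M] by blast
    have sub: "elts A \<subseteq> elts B"
      using A assms(2) by (auto simp: maximal_antichain_def antichain_def)
    have "E (generic_elt \<BB> U A) (uemb \<BB> U B)"
      by (rule uemb_mono[OF generic_in_M[OF A] generic_elt(2)[OF A] sub])
    with X[OF sub] X[OF subset_refl] A generic_in_M[OF A] generic_elt(2)[OF A] vfunction_graph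
    show ?thesis by blast
  qed
  moreover have "uapply \<BB> U (uemb \<BB> U f) (generic_elt \<BB> U A) \<in> M"
    if "maximal_antichain \<BB> (elts A)" "vfunction f A" for f A
    by (rule uapply_in_M[OF that(2) generic_in_M[OF that(1)] generic_elt(2)[OF that(1)]])
  ultimately show ?thesis
    using ufunction_uemb generic_elt_unique uapply_in_M by auto
qed

end
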